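(* Let $\mathcal K$ be an oriented virtual knot and $A$ an abelian group. For an oriented parity $p$ on the diagrams of $\mathcal K$ with coefficients in $A$ let $\delta_p$ denote its parity cycle, and for an invariant normalized 1-cycle $\delta$ on the diagrams of $\mathcal K$ with coefficients in $A$ let $p^\delta$ denote the oriented parity $p^\delta_D(v)=D^l_v\cdot\delta_D$. Then: (1) for any oriented parity $p$, the parity $p^{\delta_p}$ coincides with $p$; (2) for any invariant normalized 1-cycle $\delta$, the parity cycle $\delta_{p^\delta}$ coincides with $\delta$.
   Context: Diagrams. A virtual knot diagram $D$ is a generic oriented closed curve in the plane whose double points are marked classical (with over/under information) or virtual. A virtual knot $\mathcal K$ is a class of diagrams modulo isotopy, classical Reidemeister moves R1, R2, R3 and detour moves (replacing a path containing only virtual crossings by another path with the same ends containing only virtual crossings). $\mathcal V(D)$ is the set of classical crossings; $\mathcal A(D)$ is the set of arcs, i.e. pieces of $D$ between consecutive classical crossings (one closed arc if there are no classical crossings). A move $f\colon D\to D'$ induces a partial bijection $f_*\colon\mathcal V(D)\to\mathcal V(D')$ between surviving crossings. Arcs $a\in\mathcal A(D)$, $a'\in\mathcal A(D')$ are correspondent under a Reidemeister move if they share a point outside the region of the move; isotopies and detour moves induce a bijection of arcs. Local picture. Draw a classical crossing $v$ with both strands directed upward: the incoming arcs are SW, SE, the outgoing ones NW, NE, and the strands run SW$\to$NE and SE$\to$NW. The oriented smoothing at $v$ splits $D$ into the left half $D^l_v$ (leaving $v$ along NW, returning along SW) and the right half $D^r_v$ (leaving along NE, returning along SE). Chains. $C_1(D,A)$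 is the group of $A$-linear combinations of arcs, i.e. 1-chains of the graph $\tilde D$ with vertices $\mathcal V(D)$ and edges $\mathcal A(D)$ oriented along $D$; $H_1(D,A)$ is its subgroup of 1-cycles (at each crossing the sum of incoming values equals the sum of outgoing values). The graph $\tilde D$ is embedded in the closed oriented surface $AD(D)$ obtained by gluing discs to the boundary of the ribbon surface that is the (immersed) neighbourhood of $D$ (virtual crossings not being vertices). $C_1\cdot C_2$ denotes the intersection number in $AD(D)$, a transverse intersection counting $+1$ when (tangent of $C_1$, tangent of $C_2$) is positively oriented. $D$, $D^l_v$, $D^r_v$ are viewed as integral 1-cycles. Oriented parity. A family of maps $p_D\colon\mathcal V(D)\to A$ for all diagrams $D$ of $\mathcal K$ such that: (P0) $p_D(v)=p_{D'}(f_*(v))$ for every move $f\colon D\to D'$ and every $v$ for which $f_*(v)$ exists; (P1) $p_D(v)=0$ if $v$ disappears in a decreasing R1; (P2) $p_D(v_1)+p_D(v_2)=0$ if $v_1,v_2$ disappear in a decreasing R2; (P3+) $\sum_{i=1}^3\epsilon_\Delta(v_i)p_D(v_i)=0$ if $v_1,v_2,v_3$ are the vertices of the disappearing triangle $\Delta$ of an R3. Here $\epsilon_\Delta(v)=+1$ if $\Delta$ lies to the left or right of $v$ in the local picture (between SW and NW, or between SE and NE) and $-1$ if it lies above or below $v$. Parity cycle. For $a\in\mathcal A(D)$ take two disjoint subsegments of $a$, bring them by detour moves side by side, parallel and in the same direction, and apply an increasing R2 to them. Let $v$ be the new crossing at which both strands enter the new bigon. Then $\delta_a$ is the value of $p$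 at $v$ (it does not depend on the choices), and the parity cycle of $p$ is $\delta_{p,D}=\sum_{a\in\mathcal A(D)}\delta_a\cdot a$. It is known to be an invariant normalized 1-cycle. A family $\gamma_D\in C_1(D,A)$ is invariant if $\gamma_D(a)=\gamma_{D'}(a')$ for every move $D\to D'$ and all correspondent arcs $a,a'$. A cycle $\delta_D\in H_1(D,A)$ is normalized if $D\cdot\delta_D=0$. For an invariant normalized cycle $\delta$, $p^\delta$ is known to be an oriented parity. *)

theory Defs
  imports Main
begin

section \<open>Diagrams\<close>

text \<open>
  A virtual knot diagram is encoded by its classical crossings, its arcs, and the
  local picture at each crossing, both strands being drawn upward: which arc occupies
  each of the four corners of the picture, and which strand is the overpass. This is the graph
  of the diagram with the cyclic order of the half-edges at each vertex, i.e. its ribbon surface,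
  and it is the same information as the signed oriented Gauss diagram.
  Virtual crossings are not vertices, so no planarity is required. Two plane diagrams have
  isomorphic encodings iff they are related by isotopies and detour moves, and
  every encoding comes from a plane diagram. Isotopies and detour moves therefore
  appear below as the isomorphisms (\<open>iso_move\<close>), each with the bijections of crossings and arcs
  it induces.
\<close>

datatype slot = SW | SE | NW | NE

fun opp :: "slot \<Rightarrow> slot" where
  "opp SW = NE" | "opp NE = SW" | "opp SE = NW" | "opp NW = SE"

definition outgoing :: "slot \<Rightarrow> bool" where
  "outgoing s \<longleftrightarrow> s \<in> {NW, NE}"

text \<open>\<open>up_right_over D v\<close>: at \<open>v\<close> the strand SW-NE passes over the strand SE-NW. The values
  of \<open>arc D v\<close> and \<open>up_right_over D v\<close> matter only for \<open>v \<in> verts D\<close>.\<close>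

record diagram =
  verts :: "nat set"
  arcs :: "nat set"
  arc :: "nat \<Rightarrow> slot \<Rightarrow> nat"
  up_right_over :: "nat \<Rightarrow> bool"

definition over_at :: "diagram \<Rightarrow> nat \<Rightarrow> slot \<Rightarrow> bool" where
  "over_at D v s \<longleftrightarrow> (s \<in> {SW, NE} \<longleftrightarrow> up_right_over D v)"

text \<open>Passing straight through a crossing of \<open>S\<close>, from an incoming arc to the outgoing one.\<close>

definition steps :: "diagram \<Rightarrow> nat set \<Rightarrow> (nat \<times> nat) set" where
  "steps D S = {(arc D v s, arc D v (opp s)) | v s. v \<in> S \<and> \<not> outgoing s}"

text \<open>Every arc has one initial and one terminal end, and the arcs form one closed curve.
  A diagram without classical crossings has a single, closed, arc.\<close>

definition is_diagram :: "diagram \<Rightarrow> bool" where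
  "is_diagram D \<longleftrightarrow>
     finite (verts D) \<and> finite (arcs D) \<and>
     (if verts D = {} then card (arcs D) = 1
      else bij_betw (\<lambda>(v, s). arc D v s) (verts D \<times> {s. outgoing s}) (arcs D) \<and>
           bij_betw (\<lambda>(v, s). arc D v s) (verts D \<times> {s. \<not> outgoing s}) (arcs D) \<and>
           (\<forall>a\<in>arcs D. \<forall>b\<in>arcs D. (a, b) \<in> (steps D (verts D))\<^sup>*))"


section \<open>Moves\<close>

text \<open>A corner of a face at a crossing: \<open>West\<close> lies between SW and NW, \<open>East\<close> between SE and NE,
  \<open>South\<close> between SW and SE, \<open>North\<close> between NW and NE. Running along the boundary of a
  face with the face on the left, one arrives at the corner \<open>c\<close> through the half-edge
  \<open>arrive c\<close> and departs through \<open>depart c\<close>.\<close>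

datatype corner = West | East | South | North

fun arrive :: "corner \<Rightarrow> slot" where
  "arrive West = SW" | "arrive South = SE" | "arrive East = NE" | "arrive North = NW"

fun depart :: "corner \<Rightarrow> slot" where
  "depart West = NW" | "depart South = SW" | "depart East = SE" | "depart North = NE"

text \<open>A side of a face, from the corner \<open>c\<close> at \<open>v\<close> to the corner \<open>d\<close> at \<open>w\<close>. The two half-edges
  must be different ends of the same arc.\<close>

fun side :: "diagram \<Rightarrow> nat \<times> corner \<Rightarrow> nat \<times> corner \<Rightarrow> bool" where
  "side D (v, c) (w, d) \<longleftrightarrow>
     arc D v (depart c) = arc D w (arrive d) \<and> outgoing (depart c) \<noteq> outgoing (arrive d)"

text \<open>The strand containing this side has the same level (over or under) at both of its ends.\<close>

fun level_side :: "diagram \<Rightarrow> nat \<times> corner \<Rightarrow> nat \<times> corner \<Rightarrow> bool" where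
  "level_side D (v, c) (w, d) \<longleftrightarrow> over_at D v (depart c) = over_at D w (arrive d)"

text \<open>\<open>D'\<close> is \<open>D\<close> without the crossings in \<open>S\<close>. The map \<open>q\<close> sends each arc of \<open>D\<close> to the arc of
  \<open>D'\<close> into which it is merged.\<close>

definition erase :: "diagram \<Rightarrow> nat set \<Rightarrow> (nat \<Rightarrow> nat) \<Rightarrow> diagram \<Rightarrow> bool" where
  "erase D S q D' \<longleftrightarrow>
     verts D' = verts D - S \<and> arcs D' = q ` arcs D \<and>
     (\<forall>a\<in>arcs D. \<forall>b\<in>arcs D. q a = q b \<longleftrightarrow> (a, b) \<in> (steps D S \<union> (steps D S)\<inverse>)\<^sup>*) \<and>
     (\<forall>v\<in>verts D'. (\<forall>s. arc D' v s = q (arc D v s)) \<and>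
        up_right_over D' v = up_right_over D v)"

definition iso_move :: "diagram \<Rightarrow> diagram \<Rightarrow> (nat \<Rightarrow> nat) \<Rightarrow> (nat \<Rightarrow> nat) \<Rightarrow> bool" where
  "iso_move D D' f g \<longleftrightarrow> is_diagram D \<and> is_diagram D' \<and>
     bij_betw f (verts D) (verts D') \<and> bij_betw g (arcs D) (arcs D') \<and>
     (\<forall>v\<in>verts D. (\<forall>s. arc D' (f v) s = g (arc D v s)) \<and>
        up_right_over D' (f v) = up_right_over D v)"

text \<open>\<open>r1_move\<close> and \<open>r2_move\<close> are the decreasing moves; they erase the crossings of a monogonal,
  respectively bigonal, face. Surviving crossings keep their names.\<close>

definition r1_move :: "diagram \<Rightarrow> nat \<times> corner \<Rightarrow> (nat \<Rightarrow> nat) \<Rightarrow> diagram \<Rightarrow> bool" where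
  "r1_move D x q D' \<longleftrightarrow> is_diagram D \<and> is_diagram D' \<and>
     fst x \<in> verts D \<and> side D x x \<and> erase D {fst x} q D'"

definition r2_move ::
  "diagram \<Rightarrow> nat \<times> corner \<Rightarrow> nat \<times> corner \<Rightarrow> (nat \<Rightarrow> nat) \<Rightarrow> diagram \<Rightarrow> bool" where
  "r2_move D x y q D' \<longleftrightarrow> is_diagram D \<and> is_diagram D' \<and>
     {fst x, fst y} \<subseteq> verts D \<and> fst x \<noteq> fst y \<and> side D x y \<and> side D y x \<and>
     level_side D x y \<and> erase D {fst x, fst y} q D'"

text \<open>In a third Reidemeister move each strand of the triangle meets the other two in the
  opposite order. Below, \<open>(u, b)\<close>, \<open>(v, c)\<close>, \<open>(w, d)\<close> are consecutive
  corners of the triangle. The new triangle lies in the opposite corners; its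
  sides reuse the names of the old sides.\<close>

fun r3_vertex :: "diagram \<Rightarrow> diagram \<Rightarrow>
    nat \<times> corner \<Rightarrow> nat \<times> corner \<Rightarrow> nat \<times> corner \<Rightarrow> bool" where
  "r3_vertex D D' (u, b) (v, c) (w, d) \<longleftrightarrow>
     arc D' v (opp (depart c)) = arc D v (depart c) \<and>
     arc D' v (depart c) = arc D w (opp (arrive d)) \<and>
     arc D' v (opp (arrive c)) = arc D v (arrive c) \<and>
     arc D' v (arrive c) = arc D u (opp (depart b))"

text \<open>That some side is level means that the three strands are not cyclically layered:
  one lies over the other two and one lies under the other two.\<close>

definition r3_move :: "diagram \<Rightarrow>
    nat \<times> corner \<Rightarrow> nat \<times> corner \<Rightarrow> nat \<times> corner \<Rightarrow> diagram \<Rightarrow> bool" where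
  "r3_move D x y z D' \<longleftrightarrow> is_diagram D \<and> is_diagram D' \<and>
     {fst x, fst y, fst z} \<subseteq> verts D \<and> distinct [fst x, fst y, fst z] \<and>
     side D x y \<and> side D y z \<and> side D z x \<and>
     (level_side D x y \<or> level_side D y z \<or> level_side D z x) \<and>
     verts D' = verts D \<and> arcs D' = arcs D \<and>
     (\<forall>v\<in>verts D. up_right_over D' v = up_right_over D v) \<and>
     (\<forall>v\<in>verts D - {fst x, fst y, fst z}. arc D' v = arc D v) \<and>
     r3_vertex D D' z x y \<and> r3_vertex D D' x y z \<and> r3_vertex D D' y z x"

definition departing_arc :: "diagram \<Rightarrow> nat \<times> corner \<Rightarrow> nat" where
  "departing_arc D x = arc D (fst x) (depart (snd x))"

text \<open>\<open>move D D' F C\<close>: a move from \<open>D\<close> to \<open>D'\<close>, where \<open>F\<close> is the graph of the induced partial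
  bijection of crossings and \<open>C\<close> is the correspondence of arcs. The only arcs
  without a point outside the region of a Reidemeister move are the sides of
  the vanishing monogon or bigon and the sides of the old and new triangles.\<close>

inductive move :: "diagram \<Rightarrow> diagram \<Rightarrow> (nat \<times> nat) set \<Rightarrow> (nat \<times> nat) set \<Rightarrow> bool" where
  iso: "iso_move D D' f g \<Longrightarrow>
    move D D' {(v, f v) | v. v \<in> verts D} {(a, g a) | a. a \<in> arcs D}"
| r1: "r1_move D x q D' \<Longrightarrow>
    move D D' (Id_on (verts D')) {(a, q a) | a. a \<in> arcs D - {departing_arc D x}}"
| r2: "r2_move D x y q D' \<Longrightarrow>
    move D D' (Id_on (verts D'))
      {(a, q a) | a. a \<in> arcs D - {departing_arc D x, departing_arc D y}}"
| r3: "r3_move D x y z D' \<Longrightarrow>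
    move D D' (Id_on (verts D))
      (Id_on (arcs D - {departing_arc D x, departing_arc D y, departing_arc D z}))"
| inverse: "move D D' F C \<Longrightarrow> move D' D (F\<inverse>) (C\<inverse>)"

definition virtual_knot :: "diagram set \<Rightarrow> bool" where
  "virtual_knot K \<longleftrightarrow>
     (\<exists>D. is_diagram D \<and> K = {D'. (D, D') \<in> {(E, E'). \<exists>F C. move E E' F C}\<^sup>*})"


section \<open>Chains and intersection numbers\<close>

text \<open>A 1-chain of \<open>D\<close> is a function on arcs, of which only the values on \<open>arcs D\<close> matter.\<close>

definition is_cycle :: "diagram \<Rightarrow> (nat \<Rightarrow> 'a::ab_group_add) \<Rightarrow> bool" where
  "is_cycle D y \<longleftrightarrow>
     (\<forall>v\<in>verts D. y (arc D v SW) + y (arc D v SE) = y (arc D v NW) + y (arc D v NE))"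

definition int_scale :: "int \<Rightarrow> 'a::ab_group_add \<Rightarrow> 'a" where
  "int_scale k a = (if k \<ge> 0 then \<Sum>i<nat k. a else - (\<Sum>i<nat (- k). a))"

text \<open>The intersection number in the closed surface of an integral cycle \<open>x\<close> with a cycle \<open>y\<close>:
  push \<open>x\<close> off the graph to its left. Near a crossing the pushed strands arrive from
  the western (copy of SW) and southern (copy of SE) corners and depart into the western (copy
  of NW) and northern (copy of NE) ones. Lead all of them through the western corner. Then
  the copy of SE crosses the arc SW from its right to its left, an intersection of
  sign -1, the copy of NE crosses the arc NW from its left to its right,
  an intersection of sign +1, and there are no other intersections.\<close>

definition intersection :: "diagram \<Rightarrow> (nat \<Rightarrow> int) \<Rightarrow> (nat \<Rightarrow> 'a::ab_group_add) \<Rightarrow> 'a" where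
  "intersection D x y =
     (\<Sum>v\<in>verts D. int_scale (x (arc D v NE)) (y (arc D v NW))
                  - int_scale (x (arc D v SE)) (y (arc D v SW)))"

definition whole :: "diagram \<Rightarrow> nat \<Rightarrow> int" where
  "whole D a = (if a \<in> arcs D then 1 else 0)"

text \<open>Leave \<open>v\<close> along NW and follow the curve until it first comes back to \<open>v\<close>; as the curve is
  connected, it comes back along SW.\<close>

definition left_half :: "diagram \<Rightarrow> nat \<Rightarrow> nat \<Rightarrow> int" where
  "left_half D v a = (if (arc D v NW, a) \<in> (steps D (verts D - {v}))\<^sup>* then 1 else 0)"


section \<open>Parities and cycles\<close>

fun corner_sign :: "corner \<Rightarrow> 'a::ab_group_add \<Rightarrow> 'a" where
  "corner_sign West a = a" | "corner_sign East a = a" |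
  "corner_sign South a = - a" | "corner_sign North a = - a"

definition oriented_parity ::
  "diagram set \<Rightarrow> (diagram \<Rightarrow> nat \<Rightarrow> 'a::ab_group_add) \<Rightarrow> bool" where
  "oriented_parity K p \<longleftrightarrow>
     (\<forall>D\<in>K. \<forall>D' F C v v'. move D D' F C \<longrightarrow> (v, v') \<in> F \<longrightarrow> p D v = p D' v') \<and>
     (\<forall>D\<in>K. \<forall>x q D'. r1_move D x q D' \<longrightarrow> p D (fst x) = 0) \<and>
     (\<forall>D\<in>K. \<forall>x y q D'. r2_move D x y q D' \<longrightarrow> p D (fst x) + p D (fst y) = 0) \<and>
     (\<forall>D\<in>K. \<forall>x y z D'. r3_move D x y z D' \<longrightarrow>
        corner_sign (snd x) (p D (fst x)) + corner_sign (snd y) (p D (fst y))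
        + corner_sign (snd z) (p D (fst z)) = 0)"

definition invariant_normalized_cycle ::
  "diagram set \<Rightarrow> (diagram \<Rightarrow> nat \<Rightarrow> 'a::ab_group_add) \<Rightarrow> bool" where
  "invariant_normalized_cycle K \<delta> \<longleftrightarrow>
     (\<forall>D\<in>K. \<forall>D' F C a a'. move D D' F C \<longrightarrow> (a, a') \<in> C \<longrightarrow> \<delta> D a = \<delta> D' a') \<and>
     (\<forall>D\<in>K. is_cycle D (\<delta> D) \<and> intersection D (whole D) (\<delta> D) = 0)"

text \<open>\<open>E\<close> arises from \<open>D\<close> by an increasing second Reidemeister move that makes two parallel
  subsegments of the arc \<open>a\<close> cross at \<open>v\<close> and then at \<open>w\<close>. Both strands enter the
  bigon at \<open>v\<close>, where it occupies the northern corner, and leave it at \<open>w\<close>.\<close>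

definition self_r2 :: "diagram \<Rightarrow> nat \<Rightarrow> diagram \<Rightarrow> nat \<Rightarrow> bool" where
  "self_r2 D a E v \<longleftrightarrow>
     (\<exists>w q. r2_move E (v, North) (w, South) q D \<and>
        q (arc E v SW) = a \<and> q (arc E v SE) = a)"

definition parity_cycle ::
  "(diagram \<Rightarrow> nat \<Rightarrow> 'a::ab_group_add) \<Rightarrow> diagram \<Rightarrow> nat \<Rightarrow> 'a" where
  "parity_cycle p D a = (THE t. \<exists>E v. self_r2 D a E v \<and> t = p E v)"

definition cycle_parity ::
  "(diagram \<Rightarrow> nat \<Rightarrow> 'a::ab_group_add) \<Rightarrow> diagram \<Rightarrow> nat \<Rightarrow> 'a" where
  "cycle_parity \<delta> D v = intersection D (left_half D v) (\<delta> D)"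

end

theory Submission
  imports Defs
begin

text \<open>
  \<^bold>\<open>Words.\<close> A diagram with at least one crossing is determined up to isomorphism by its Gauss
  word, the cyclic list of the passages through crossings met along the curve (\<open>reads\<close>). A
  decreasing second move deletes the four letters of two crossings, and a third move exchanges
  the two letters of three adjacent pairs. So diagrams and moves are produced by writing down
  words, and virtual crossings never have to be drawn: any two places of the word may be brought
  side by side.

  \<^bold>\<open>From a cycle to a parity and back.\<close> Let \<open>v\<close>, \<open>w\<close> be the crossings of the bigon in the
  diagram that defines the coefficient of the arc \<open>a\<close>. Following the curve from the upper left
  of \<open>v\<close> back to \<open>v\<close>, one either meets only \<open>w\<close> or goes once around the whole old diagram. In
  the first case the left half at \<open>v\<close> crosses the cycle once, at \<open>w\<close>, on a piece of the old arc
  \<open>a\<close>, so the intersection number is \<open>\<delta> a\<close>. In the second case it differs from this by the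
  intersection number with the whole curve, which is zero because \<open>\<delta>\<close> is normalized.

  \<^bold>\<open>From a parity to a cycle and back.\<close> Let \<open>F\<^sub>b(e)\<close> be the value of the parity at a new
  crossing where a strand \<open>b\<close>, lying to the left of a strand \<open>e\<close> and parallel to it, crosses \<open>e\<close>
  to the right before crossing back (\<open>crossing_value\<close>). Thus \<open>F\<^sub>e(e) = \<delta>\<^sub>e\<close> is the coefficient
  of the parity cycle. If \<open>b\<close> and \<open>e\<close> are antiparallel, \<open>b\<close> lying to the right of \<open>e\<close>, the
  crossing where \<open>b\<close> comes from the left has the value \<open>F\<^sub>b(e) - \<delta>\<^sub>e\<close> (\<open>val_antiparallel_word\<close>).
  This is the relation for the triangle that \<open>b\<close>, \<open>e\<close> and a second piece of \<open>e\<close> form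
  (\<open>compare\<close>). Each of the three values in it is computed from crossings of its own, so changing
  the choices for one of them leaves the other two alone: all of them are independent of
  choices, in particular of which strand is on top.

  Now let \<open>s\<close>, \<open>t\<close> be the arcs entering a crossing \<open>w\<close> from SW and SE, and let \<open>m\<close>, \<open>n\<close> be the
  ones leaving it to NW and NE. If a strand \<open>b\<close> is laid across the crossing so that it cuts a
  triangle off its western, northern or southern corner, then the triangle relation says \<open>p(w) =
  F\<^sub>b(m) - F\<^sub>b(s)\<close>, \<open>F\<^sub>b(m) - \<delta>\<^sub>m = p(w) + F\<^sub>b(n)\<close> and \<open>F\<^sub>b(s) - \<delta>\<^sub>s = F\<^sub>b(t) - p(w)\<close>
  respectively (\<open>crossing_relations\<close>). Hence \<open>F\<^sub>b(s) - F\<^sub>b(n) = \<delta>\<^sub>m\<close> and \<open>F\<^sub>b(t) - F\<^sub>b(m) = -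
  \<delta>\<^sub>s\<close>: along the curve, \<open>F\<^sub>b\<close> changes at every passage by exactly the contribution of this
  passage to the intersection number with \<open>\<delta>\<close>. Summing over the left half at \<open>w\<close>, which leads
  from \<open>m\<close> to \<open>s\<close>, gives \<open>F\<^sub>b(m) - F\<^sub>b(s) = p(w)\<close>.
\<close>

section \<open>Cyclic words\<close>

text \<open>
  Reading the cyclic word from just behind \<open>x\<close>; the final \<open>[x]\<close> makes \<open>x\<close> its own successor in a
  word with one letter.
\<close>

definition follows :: "'b list \<Rightarrow> 'b \<Rightarrow> 'b \<Rightarrow> bool" where
  "follows W x y \<longleftrightarrow> (\<exists>A B. W = A @ x # B \<and> y = hd (B @ A @ [x]))"

lemma follows_append: "follows (A @ x # y # B) x y"
  unfolding follows_def by (intro exI[of _ A] exI[of _ "y # B"]) simp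

lemma follows_rotate: "follows (A @ B) x y \<Longrightarrow> follows (B @ A) x y"
proof -
  assume "follows (A @ B) x y"
  then obtain P Q where PQ: "A @ B = P @ x # Q" "y = hd (Q @ P @ [x])"
    unfolding follows_def by blast
  from PQ(1) consider (1) R where "A = P @ x # R" "Q = R @ B" | (2) R where "P = A @ R"
    "B = R @ x # Q"
    by (auto simp: append_eq_append_conv2 append_eq_Cons_conv)
  then show ?thesis
  proof cases
    case 1
    then show ?thesis unfolding follows_def using PQ(2)
      by (intro exI[of _ "B @ P"] exI[of _ R]) auto
  next
    case 2
    then show ?thesis unfolding follows_def using PQ(2)
      by (intro exI[of _ R] exI[of _ "Q @ A"]) auto
  qed
qed

lemma follows_Cons:
  assumes "distinct (x # R)"
  shows "follows (x # R) x y \<longleftrightarrow> y = hd (R @ [x])"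
proof
  assume "follows (x # R) x y"
  then obtain P Q where PQ: "x # R = P @ x # Q" "y = hd (Q @ P @ [x])"
    unfolding follows_def by blast
  then have "P = []" using assms by (cases P) auto
  then show "y = hd (R @ [x])" using PQ by simp
next
  assume "y = hd (R @ [x])"
  then show "follows (x # R) x y" unfolding follows_def by (intro exI[of _ "[]"] exI[of _ R]) simp
qed

lemma follows_ex: "x \<in> set W \<Longrightarrow> \<exists>y\<in>set W. follows W x y"
proof -
  assume "x \<in> set W"
  then obtain A B where W: "W = A @ x # B" by (meson split_list)
  have "hd (B @ A @ [x]) \<in> set (B @ A @ [x])" by (rule hd_in_set) simp
  then have "hd (B @ A @ [x]) \<in> set W" unfolding W by auto
  moreover have "follows W x (hd (B @ A @ [x]))" unfolding follows_def using W by blast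
  ultimately show ?thesis by blast
qed

lemma follows_in: "follows W x y \<Longrightarrow> x \<in> set W \<and> y \<in> set W"
proof -
  assume "follows W x y"
  then obtain A B where W: "W = A @ x # B" "y = hd (B @ A @ [x])" by (auto simp: follows_def)
  have "hd (B @ A @ [x]) \<in> set (B @ A @ [x])" by (rule hd_in_set) simp
  with W show ?thesis by auto
qed

lemma follows_unique: "distinct W \<Longrightarrow> follows W x y \<Longrightarrow> follows W x z \<Longrightarrow> y = z"
proof -
  assume d: "distinct W" and y: "follows W x y" and z: "follows W x z"
  obtain A B where W: "W = A @ x # B" using y by (auto simp: follows_def)
  have "follows (x # B @ A) x y" "follows (x # B @ A) x z"
    using follows_rotate[of A "x # B"] y z W by auto
  then show ?thesis using d W by (subst (asm) (1 2) follows_Cons) auto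
qed

lemma follows_back_ex: "y \<in> set W \<Longrightarrow> \<exists>x\<in>set W. follows W x y"
proof -
  assume "y \<in> set W"
  then obtain A B where W: "W = A @ y # B" by (meson split_list)
  show ?thesis
  proof (cases "A = []")
    case False
    then obtain A' x where "A = A' @ [x]" by (metis append_butlast_last_id)
    then show ?thesis using W follows_append[of A' x y B] by auto
  next
    case True
    show ?thesis
    proof (cases "B = []")
      case True
      with \<open>A = []\<close> W show ?thesis by (auto simp: follows_def intro!: exI[of _ "[]"])
    next
      case False
      then obtain B' x where "B = B' @ [x]" by (metis append_butlast_last_id)
      then show ?thesis using W \<open>A = []\<close> follows_rotate[of "[x]"
        "y # B'" x y] follows_append[of "[]" x y B'] by auto
    qed
  qed
qed

text \<open>
  The successor map is onto a finite set, hence injective.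
\<close>

lemma follows_inj: 
  assumes "distinct W" "follows W x z" "follows W y z" shows "x = y"
proof -
  define N where "N = (\<lambda>x. THE y. follows W x y)"
  have N: "follows W x y \<Longrightarrow> N x = y" for x y
    unfolding N_def using follows_unique[OF assms(1)] by blast
  have "N ` set W = set W"
  proof
    show "N ` set W \<subseteq> set W"
    proof
      fix z assume "z \<in> N ` set W"
      then obtain x where "x \<in> set W" "z = N x" by blast
      moreover obtain y where "y \<in> set W" "follows W x y" using follows_ex[OF \<open>x \<in> set W\<close>] by blast
      ultimately show "z \<in> set W" using N by simp
    qed
    show "set W \<subseteq> N ` set W"
    proof
      fix y assume "y \<in> set W"
      then obtain x where "x \<in> set W" "follows W x y" using follows_back_ex by metis
      then show "y \<in> N ` set W" using N by (metis imageI)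
    qed
  qed
  then have "inj_on N (set W)" by (simp add: eq_card_imp_inj_on)
  moreover have "N x = N y" using N assms(2,3) by simp
  ultimately show ?thesis using follows_in[OF assms(2)] follows_in[OF assms(3)]
    by (simp add: inj_on_def)
qed

lemma follows_map: "follows W x y \<Longrightarrow> follows (map f W) (f x) (f y)"
proof -
  assume "follows W x y"
  then obtain A B where W: "W = A @ x # B" "y = hd (B @ A @ [x])" unfolding follows_def by blast
  have "f y = hd (map f (B @ A @ [x]))" using W(2) by (subst hd_map) auto
  then show ?thesis unfolding follows_def W(1)
    by (intro exI[of _ "map f A"] exI[of _ "map f B"]) simp
qed

text \<open>
  Adjacency without wrapping around. Unlike \<open>follows\<close> it survives when letters are added on
  either side, so it can be checked by walking through an explicit word.
\<close>

definition adjacent :: "'b list \<Rightarrow> 'b \<Rightarrow> 'b \<Rightarrow> bool" where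
  "adjacent W x y \<longleftrightarrow> (\<exists>A B. W = A @ x # y # B)"

lemma adjacent_here: "adjacent (x # y # B) x y"
  unfolding adjacent_def by (intro exI[of _ "[]"] exI[of _ B]) simp

lemma adjacent_append: "adjacent W x y \<Longrightarrow> adjacent (A @ W) x y"
  unfolding adjacent_def by (elim exE) (metis append.assoc)

lemma adjacent_Cons: "adjacent W x y \<Longrightarrow> adjacent (a # W) x y"
  using adjacent_append[of W x y "[a]"] by simp

lemmas adjacent_rules = adjacent_here adjacent_append adjacent_Cons

lemma adjacent_left: "adjacent A x y \<Longrightarrow> adjacent (A @ B) x y"
  unfolding adjacent_def by (elim exE) (metis append.assoc append_Cons)

lemma adjacent_Cons_iff:
  "adjacent (a # b # W) x y \<longleftrightarrow> (a = x \<and> b = y) \<or> adjacent (b # W) x y"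
  "\<not> adjacent [a] x y"
proof -
  show "\<not> adjacent [a] x y" by (auto simp: adjacent_def Cons_eq_append_conv)
  show "adjacent (a # b # W) x y \<longleftrightarrow> (a = x \<and> b = y) \<or> adjacent (b # W) x y"
    using adjacent_here[of a b W] adjacent_Cons[of "b # W" x y a]
    by (auto simp: adjacent_def Cons_eq_append_conv)
qed

lemma adjacent_follows: "adjacent W x y \<Longrightarrow> follows W x y"
  unfolding adjacent_def by (elim exE) (simp add: follows_append)

text \<open>
  If only the letters with \<open>P\<close> are kept, the piece of the curve that ends at \<open>x\<close> becomes part of
  the piece that ends at the first kept letter at or after \<open>x\<close>. The second copy of \<open>W\<close> makes the
  search wrap around.
\<close>

definition first_kept :: "('b \<Rightarrow> bool) \<Rightarrow> 'b list \<Rightarrow> 'b \<Rightarrow> 'b" where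
  "first_kept P W x = hd (filter P (dropWhile (\<lambda>y. y \<noteq> x) W @ W))"

lemma first_kept_eq:
  assumes "distinct (A @ x # B)" "\<exists>y\<in>set (A @ x # B). P y"
  shows "first_kept P (A @ x # B) x = hd (filter P (x # B @ A))"
proof -
  have "dropWhile (\<lambda>y. y \<noteq> x) (A @ x # B) = x # B"
    using assms(1) by (subst dropWhile_append2) auto
  moreover have "filter P (x # B @ A) \<noteq> []" using assms(2) by (auto simp: filter_empty_conv)
  then have "hd (filter P (x # B @ A) @ filter P (x # B)) = hd (filter P (x # B @ A))"
    by (rule hd_append2)
  moreover have "filter P ((x # B) @ A @ x # B) = filter P (x # B @ A) @ filter P (x # B)" by simp
  ultimately show ?thesis unfolding first_kept_def by (simp only:)
qed

lemma first_kept_same: "x \<in> set W \<Longrightarrow> P x \<Longrightarrow> first_kept P W x = x"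
proof -
  assume x: "x \<in> set W" "P x"
  have "dropWhile (\<lambda>y. y \<noteq> x) W = x # tl (dropWhile (\<lambda>y. y \<noteq> x) W)"
    using x(1) by (induction W) auto
  then show ?thesis unfolding first_kept_def using x(2)
    by (metis append_Cons filter.simps(2) list.sel(1))
qed

lemma first_kept_step:
  assumes d: "distinct W" and k: "\<exists>z\<in>set W. P z" and x: "\<not> P x" and f: "follows W x y"
  shows "first_kept P W x = first_kept P W y"
proof -
  obtain A B where W: "W = A @ x # B" "y = hd (B @ A @ [x])" using f unfolding follows_def by blast
  show ?thesis
  proof (cases B)
    case (Cons b B')
    then show ?thesis using W d k x first_kept_eq[of A x B P] first_kept_eq[of "A @ [x]" y B' P]
      by simp
  next
    case Nil
    then show ?thesis using W d k x first_kept_eq[of A x B P] first_kept_eq[of "[]" y "tl A @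
      [x]" P]
      by (cases A) auto
  qed
qed

lemma follows_filter:
  assumes d: "distinct W" and x: "P x" and f: "follows W x y" and g: "follows (filter P W) x z"
  shows "z = first_kept P W y"
proof -
  obtain A B where W: "W = A @ x # B" "y = hd (B @ A @ [x])" using f unfolding follows_def by blast
  have k: "\<exists>y\<in>set W. P y" using W x by auto
  have "follows (x # filter P B @ filter P A) x z"
    using g follows_rotate[of "filter P A" "x # filter P B" x z] W x by simp
  then have z: "z = hd (filter P B @ filter P A @ [x])"
    using d W by (subst (asm) follows_Cons) auto
  show ?thesis
  proof (cases B)
    case (Cons b B')
    then show ?thesis using z W d k x first_kept_eq[of "A @ [x]" y B' P] by simp
  next
    case Nil
    then show ?thesis using z W d k x first_kept_eq[of "[]" y "tl A @ [x]" P] first_kept_same[of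
      x W P]
      by (cases A) auto
  qed
qed

lemma first_kept_in: "\<exists>y\<in>set W. P y \<Longrightarrow> first_kept P W x \<in> set (filter P W)"
proof -
  assume "\<exists>y\<in>set W. P y"
  then have "filter P (dropWhile (\<lambda>y. y \<noteq> x) W @ W) \<noteq> []" by (auto simp: filter_empty_conv)
  then have "first_kept P W x \<in> set (filter P (dropWhile (\<lambda>y. y \<noteq> x) W @ W))"
    unfolding first_kept_def by (rule hd_in_set)
  then show ?thesis using set_dropWhileD by fastforce
qed

section \<open>Gauss words of diagrams\<close>

abbreviation lft :: "nat \<Rightarrow> nat \<times> slot" where "lft v \<equiv> (v, SW)"

abbreviation rgt :: "nat \<Rightarrow> nat \<times> slot" where "rgt v \<equiv> (v, SE)"

text \<open>
  Every crossing is passed once from SW and once from SE.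
\<close>

definition gauss_word :: "(nat \<times> slot) list \<Rightarrow> bool" where
  "gauss_word W \<longleftrightarrow> distinct W \<and> W \<noteq> [] \<and> (\<exists>V. set W = V \<times> {SW, SE})"

lemma gauss_word_rotate: "gauss_word (A @ B) \<Longrightarrow> gauss_word (B @ A)"
  unfolding gauss_word_def by (auto simp: Un_commute)

lemma gauss_word_set: "gauss_word W \<Longrightarrow> set W = fst ` set W \<times> {SW, SE}"
  unfolding gauss_word_def by force

lemma gauss_word_slots: "gauss_word W \<Longrightarrow> x \<in> set W \<Longrightarrow> snd x = SW \<or> snd x = SE"
proof -
  assume w: "gauss_word W" and x: "x \<in> set W"
  have "x \<in> fst ` set W \<times> {SW, SE}" using x gauss_word_set[OF w] by (rule subst[rotated])
  then show ?thesis by auto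
qed

lemma not_outgoing_slots: "{s. \<not> outgoing s} = {SW, SE}" "{s. outgoing s} = {NW, NE}"
  unfolding outgoing_def using slot.exhaust by auto

lemma opp_opp[simp]: "opp (opp s) = s" by (cases s) auto

lemma outgoing_opp[simp]: "outgoing (opp s) \<longleftrightarrow> \<not> outgoing s" by (cases s) (auto simp: outgoing_def)

abbreviation arc_to :: "diagram \<Rightarrow> nat \<times> slot \<Rightarrow> nat" where
  "arc_to D x \<equiv> arc D (fst x) (snd x)"

abbreviation arc_from :: "diagram \<Rightarrow> nat \<times> slot \<Rightarrow> nat" where
  "arc_from D x \<equiv> arc D (fst x) (opp (snd x))"

text \<open>
  An arc is identified with the passage at which it ends.
\<close>

definition reads :: "diagram \<Rightarrow> (nat \<times> slot) list \<Rightarrow> bool" where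
  "reads D W \<longleftrightarrow> gauss_word W \<and> verts D = fst ` set W \<and>
     bij_betw (arc_to D) (set W) (arcs D) \<and>
     (\<forall>x y. follows W x y \<longrightarrow> arc_from D x = arc_to D y)"

lemma reads_word: "reads D W \<Longrightarrow> gauss_word W" and
  reads_verts: "reads D W \<Longrightarrow> verts D = fst ` set W" and
  reads_arcs: "reads D W \<Longrightarrow> bij_betw (arc_to D) (set W) (arcs D)" and
  reads_follows: "reads D W \<Longrightarrow> follows W x y \<Longrightarrow> arc_from D x = arc_to D y"
  by (simp_all add: reads_def)

lemma reads_set: "reads D W \<Longrightarrow> set W = verts D \<times> {s. \<not> outgoing s}"
proof -
  assume "reads D W"
  then have "set W = fst ` set W \<times> {SW, SE}" "verts D = fst ` set W"
    using gauss_word_set unfolding reads_def by blast+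
  then show ?thesis unfolding not_outgoing_slots
    by (rule trans[OF _ arg_cong2[OF sym refl, of _ _ Sigma]])
qed

lemma reads_rotate: "reads D (A @ B) \<Longrightarrow> reads D (B @ A)"
  unfolding reads_def using gauss_word_rotate[of A B] follows_rotate[of B A]
  by (auto simp: Un_commute)

lemma reads_step:
  assumes "reads D W" "follows W x y" "fst x \<in> S"
  shows "(arc_to D x, arc_to D y) \<in> steps D S"
proof -
  have "\<not> outgoing (snd x)" using reads_set[OF assms(1)] follows_in[OF assms(2)]
    by (metis mem_Times_iff mem_Collect_eq)
  moreover have "arc_from D x = arc_to D y" using assms(1,2) unfolding reads_def by simp
  ultimately show ?thesis unfolding steps_def mem_Collect_eq using assms(3)
    by (intro exI[of _ "fst x"] exI[of _ "snd x"]) simp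
qed

lemma reads_steps_iff:
  assumes "reads D W" "S \<subseteq> verts D"
  shows "(a, b) \<in> steps D S \<longleftrightarrow> (\<exists>x y. follows W x y \<and> fst x \<in> S \<and> a = arc_to D x \<and> b = arc_to D y)"
proof
  assume "(a, b) \<in> steps D S"
  then obtain v s where vs: "v \<in> S" "\<not> outgoing s" "a = arc D v s" "b = arc D v (opp s)"
    unfolding steps_def by auto
  have "(v, s) \<in> set W" using assms vs reads_set[OF assms(1)] by auto
  then obtain y where y: "follows W (v, s) y" using follows_ex by metis
  then have "arc_from D (v, s) = arc_to D y" using assms(1) unfolding reads_def by blast
  then have "b = arc_to D y" using vs by simp
  then show "\<exists>x y. follows W x y \<and> fst x \<in> S \<and> a = arc_to D x \<and> b = arc_to D y"
    using y vs by (intro exI[of _ "(v, s)"] exI[of _ y]) simp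
next
  assume "\<exists>x y. follows W x y \<and> fst x \<in> S \<and> a = arc_to D x \<and> b = arc_to D y"
  then obtain x y where xy: "follows W x y" "fst x \<in> S" "a = arc_to D x" "b = arc_to D y" by auto
  show "(a, b) \<in> steps D S" unfolding xy(3,4) by (rule reads_step[OF assms(1) xy(1,2)])
qed

lemma reads_chain:
  assumes "reads D (A @ C @ z # B)" "fst ` set C \<subseteq> S"
  shows "(arc_to D (hd (C @ [z])), arc_to D z) \<in> (steps D S)\<^sup>*"
  using assms
proof (induction C arbitrary: A)
  case Nil then show ?case by simp
next
  case (Cons c C)
  have chain: "(arc_to D (hd (C @ [z])), arc_to D z) \<in> (steps D S)\<^sup>*"
    using Cons.IH[of "A @ [c]"] Cons.prems by simp
  have "follows (A @ (c # C) @ z # B) c (hd (C @ [z]))"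
    using follows_append[of A c "hd (C @ [z])" "tl (C @ [z]) @ B"] 
    by (cases C) auto
  moreover have "fst c \<in> S" using Cons.prems(2) by simp
  ultimately have "(arc_to D c, arc_to D (hd (C @ [z]))) \<in> steps D S"
    by (intro reads_step[OF Cons.prems(1)])
  then show ?case using chain unfolding append_Cons list.sel by (rule converse_rtrancl_into_rtrancl)
qed

lemma reads_starting_at:
  assumes "reads D W" "x \<in> set W"
  obtains R where "reads D (x # R)" "set W = set (x # R)"
proof -
  obtain A B where W: "W = A @ x # B" using assms(2) by (meson split_list)
  show ?thesis
  proof (rule that[of "B @ A"])
    show "reads D (x # B @ A)" using reads_rotate[of D A "x # B"] assms W by simp
    show "set W = set (x # B @ A)" using W by auto
  qed
qed

lemma follows_iff_arcs:
  assumes r: "reads D W" and x: "x \<in> set W" and y: "y \<in> set W"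
  shows "follows W x y \<longleftrightarrow> arc_from D x = arc_to D y"
proof
  assume eq: "arc_from D x = arc_to D y"
  obtain z where z: "z \<in> set W" "follows W x z" using follows_ex[OF x] by blast
  have "arc_to D z = arc_to D y" using reads_follows[OF r z(2)] eq by simp
  then have "z = y" using inj_onD[OF bij_betw_imp_inj_on[OF reads_arcs[OF r]] _ z(1) y] by blast
  then show "follows W x y" using z(2) by simp
qed (rule reads_follows[OF r])

text \<open>
  The arcs determine the successor of every passage, so only the starting point of the word is
  free.
\<close>

lemma reads_unique:
  assumes r: "reads D W" and r': "reads D W'" and h: "hd W = hd W'"
  shows "W = W'"
proof -
  have d: "distinct W" "distinct W'" "W \<noteq> []" "W' \<noteq> []"
    using reads_word[OF r] reads_word[OF r'] by (auto simp: gauss_word_def)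
  have s: "set W = set W'" using reads_set[OF r] reads_set[OF r'] by simp
  have len: "length W = length W'" using s d by (metis distinct_card)
  have succ: "follows V (V ! i) (V ! Suc i)"
    if "Suc i < length V" for V :: "(nat \<times> slot) list" and i
    using follows_append[of "take i V" "V ! i" "V ! Suc i" "drop (Suc (Suc i)) V"] that
    by (simp add: Cons_nth_drop_Suc)
  have "W ! i = W' ! i" if "i < length W" for i
    using that
  proof (induction i)
    case 0 then show ?case using h d by (simp add: hd_conv_nth)
  next
    case (Suc i)
    have f: "follows W (W ! i) (W ! Suc i)" "follows W' (W ! i) (W' ! Suc i)"
      using succ[of i W] succ[of i W'] Suc len by simp_all
    have "arc_from D (W ! i) = arc_to D (W' ! Suc i)" by (rule reads_follows[OF r' f(2)])
    moreover have "W ! i \<in> set W" using Suc.prems by simp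
    moreover have "W' ! Suc i \<in> set W" unfolding s using Suc.prems len by simp
    ultimately have "follows W (W ! i) (W' ! Suc i)" using follows_iff_arcs[OF r] by blast
    then show ?case using follows_unique[OF d(1) f(1)] by blast
  qed
  then show ?thesis by (rule nth_equalityI[OF len])
qed

text \<open>
  That the arcs form a single closed curve is built into the word: every letter is reached from
  every other one.
\<close>

lemma reads_diagram: assumes "reads D W" shows "is_diagram D"
proof -
  have fin: "finite (verts D)" "finite (arcs D)"
    using reads_verts[OF assms] bij_betw_finite[OF reads_arcs[OF assms]] by auto
  have ne: "verts D \<noteq> {}" using reads_verts[OF assms] reads_word[OF assms]
    by (auto simp: gauss_word_def)
  have sW: "set W = verts D \<times> {s. \<not> outgoing s}" by (rule reads_set[OF assms])
  have inb: "bij_betw (\<lambda>(v, s). arc D v s) (verts D \<times> {s. \<not> outgoing s}) (arcs D)"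
    using reads_arcs[OF assms] unfolding sW[symmetric] by (simp add: case_prod_unfold)
  have step: "(arc_to D x, arc_to D y) \<in> (steps D (verts D))\<^sup>*" if xy: "x \<in> set W"
    "y \<in> set W" for x y
  proof -
    obtain R where R: "reads D (x # R)" "set W = set (x # R)"
      using reads_starting_at[OF assms xy(1)] by metis
    show ?thesis
    proof (cases "x = y")
      case False
      then obtain C B where "R = C @ y # B" using R(2) xy by (metis set_ConsD split_list)
      then have "reads D ([] @ (x # C) @ y # B)" "fst ` set (x # C) \<subseteq> verts D"
        using R reads_verts[OF assms] by auto
      from reads_chain[OF this] show ?thesis by simp
    qed simp
  qed
  have conn: "\<forall>a\<in>arcs D. \<forall>b\<in>arcs D. (a, b) \<in> (steps D (verts D))\<^sup>*"
  proof -
    have A: "arcs D = arc_to D ` set W" using reads_arcs[OF assms] by (simp add: bij_betw_def)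
    show ?thesis unfolding A
    proof (intro ballI)
      fix a b assume "a \<in> arc_to D ` set W" "b \<in> arc_to D ` set W"
      then obtain x y where xy: "x \<in> set W" "y \<in> set W" "a = arc_to D x" "b = arc_to D y" by auto
      show "(a, b) \<in> (steps D (verts D))\<^sup>*" unfolding xy(3,4) by (rule step[OF xy(1,2)])
    qed
  qed
  have outb: "bij_betw (\<lambda>(v, s). arc D v s) (verts D \<times> {s. outgoing s}) (arcs D)"
  proof -
    define N where "N = (\<lambda>x. THE y. follows W x y)"
    have dW: "distinct W" using reads_word[OF assms] by (simp add: gauss_word_def)
    have N: "N x = y" if "follows W x y" for x y
      unfolding N_def using that by (rule the_equality) (rule follows_unique[OF dW _ that])
    have NN: "follows W x (N x)" if "x \<in> set W" for x
    proof -
      obtain y where "follows W x y" using follows_ex[OF \<open>x \<in> set W\<close>] by blast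
      then show ?thesis using N by simp
    qed
    have "bij_betw N (set W) (set W)"
    proof (rule bij_betwI')
      show "(N x = N y) = (x = y)" if "x \<in> set W" "y \<in> set W" for x y
        using NN that follows_inj[OF dW] by metis
      show "N x \<in> set W" if "x \<in> set W" for x using NN[OF that] follows_in by metis
      show "\<exists>x\<in>set W. y = N x" if "y \<in> set W" for y using follows_back_ex[OF that] N by metis
    qed
    then have b: "bij_betw (arc_to D \<circ> N) (set W) (arcs D)"
      by (rule bij_betw_trans[OF _ reads_arcs[OF assms]])
    have "bij_betw (arc_from D) (set W) (arcs D)"
      using b by (rule iffD1[OF bij_betw_cong, rotated]) (simp add: reads_follows[OF assms NN])
    moreover have "bij_betw (\<lambda>(v, s). (v, opp s)) (verts D \<times> {s. outgoing s}) (set W)"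
      unfolding sW by (rule bij_betw_byWitness[where f' = "\<lambda>(v, s). (v, opp s)"])
        auto
    ultimately have "bij_betw (arc_from D \<circ> (\<lambda>(v, s). (v, opp s))) (verts D \<times> {s. outgoing s})
      (arcs D)"
      using bij_betw_trans by blast
    moreover have "arc_from D \<circ> (\<lambda>(v, s). (v, opp s)) = (\<lambda>(v, s). arc D v s)" by auto
    ultimately show ?thesis by simp
  qed
  show ?thesis unfolding is_diagram_def using fin ne inb outb conn by simp
qed

text \<open>
  Going from a passage to the next one permutes the passages. As the arcs form one closed curve,
  this permutation has a single orbit, and the Gauss word lists that orbit.
\<close>

lemma diagram_reads:
  assumes D: "is_diagram D" and ne: "verts D \<noteq> {}"
  shows "\<exists>W. reads D W"
proof -
  define P where "P = verts D \<times> {s. \<not> outgoing s}"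
  have finP: "finite P" using D unfolding P_def is_diagram_def not_outgoing_slots by auto
  have inb: "bij_betw (arc_to D) P (arcs D)"
    using D ne unfolding is_diagram_def P_def by (simp add: case_prod_unfold)
  have "bij_betw (\<lambda>(v, s). arc D v s) (verts D \<times> {s. outgoing s}) (arcs D)"
    using D ne unfolding is_diagram_def by simp
  moreover have "bij_betw (\<lambda>(v, s). (v, opp s)) P (verts D \<times> {s. outgoing s})"
      unfolding P_def by (rule bij_betw_byWitness[where f' = "\<lambda>(v, s). (v, opp s)"])
        auto
  ultimately have "bij_betw ((\<lambda>(v, s). arc D v s) \<circ> (\<lambda>(v, s). (v, opp s))) P (arcs D)"
    using bij_betw_trans by blast
  moreover have "(\<lambda>(v, s). arc D v s) \<circ> (\<lambda>(v, s). (v, opp s)) = arc_from D" by auto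
  ultimately have outb: "bij_betw (arc_from D) P (arcs D)" by simp
  define nx where "nx = inv_into P (arc_to D) \<circ> arc_from D"
  have nxb: "bij_betw nx P P" unfolding nx_def using outb inb
    by (meson bij_betw_inv_into bij_betw_trans)
  have nx_arc: "arc_to D (nx x) = arc_from D x" if "x \<in> P" for x
    unfolding nx_def o_def by (rule bij_betw_inv_into_right[OF inb bij_betw_apply[OF outb that]])
  obtain x0 where x0: "x0 \<in> P" using ne not_outgoing_slots unfolding P_def by blast
  have inP: "(nx ^^ i) x0 \<in> P" for i using x0 bij_betw_apply[OF nxb] by (induction i) auto
  have reach: "\<exists>i. x = (nx ^^ i) x0" if "x \<in> P" for x
  proof -
    have "(arc_to D x0, arc_to D x) \<in> (steps D (verts D))\<^sup>*"
      using D ne bij_betw_apply[OF inb that] bij_betw_apply[OF inb x0]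
        unfolding is_diagram_def by simp
    then have "\<exists>i. arc_to D x = arc_to D ((nx ^^ i) x0)"
    proof (induction rule: rtrancl_induct)
      case base then show ?case by (intro exI[of _ 0]) simp
    next
      case (step a b)
      then obtain i where i: "a = arc_to D ((nx ^^ i) x0)" by auto
      obtain v s where vs: "v \<in> verts D" "\<not> outgoing s" "a = arc D v s" "b = arc D v (opp s)"
        using step(2) unfolding steps_def by auto
      then have "(v, s) \<in> P" by (simp add: P_def)
      then have "(v, s) = (nx ^^ i) x0" using i vs(3)
        by (intro inj_onD[OF bij_betw_imp_inj_on[OF inb] _ _ inP]) simp_all
      then have "(nx ^^ Suc i) x0 = nx (v, s)" by simp
      then have "b = arc_to D ((nx ^^ Suc i) x0)" using nx_arc[OF \<open>(v,s) \<in> P\<close>] vs by simp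
      then show ?case by blast
    qed
    then show ?thesis using inj_onD[OF bij_betw_imp_inj_on[OF inb] _ that inP] by blast
  qed
  have inj: "i = j" if "(nx ^^ i) x0 = (nx ^^ j) x0"
    "\<And>k. 0 < k \<Longrightarrow> k \<le> max i j \<Longrightarrow> (nx ^^ k) x0 \<noteq> x0" for i j
    using that
  proof (induction i arbitrary: j)
    case 0 then show ?case by (metis funpow_0 gr_zeroI max_nat.left_neutral order_refl)
  next
    case (Suc i)
    show ?case
    proof (cases j)
      case 0 then show ?thesis using Suc.prems
        by (metis funpow_0 max_nat.right_neutral order_refl zero_less_Suc)
    next
      case (Suc j')
      have "nx ((nx ^^ i) x0) = nx ((nx ^^ j') x0)" using Suc.prems Suc by simp
      then have "(nx ^^ i) x0 = (nx ^^ j') x0"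
        using inj_onD[OF bij_betw_imp_inj_on[OF nxb] _ inP inP] by blast
      then show ?thesis using Suc.IH[of j'] Suc.prems(2) Suc by auto
    qed
  qed
  have ex: "\<exists>n>0. (nx ^^ n) x0 = x0"
  proof (rule ccontr)
    assume "\<not> ?thesis"
    then have no: "(nx ^^ k) x0 \<noteq> x0" if "0 < k" for k using that by blast
    have "inj (\<lambda>i. (nx ^^ i) x0)" by (rule injI) (rule inj, assumption, rule no)
    moreover have "range (\<lambda>i. (nx ^^ i) x0) \<subseteq> P" using inP by auto
    ultimately show False using finite_subset[OF _ finP] finite_imageD infinite_UNIV_nat by blast
  qed
  \<comment> \<open>the length of the orbit of \<open>x0\<close>\<close>
  define n where "n = (LEAST n. n > 0 \<and> (nx ^^ n) x0 = x0)"
  have n: "n > 0" "(nx ^^ n) x0 = x0" unfolding n_def using LeastI_ex[OF ex] by auto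
  have nmin: "0 < k \<Longrightarrow> k < n \<Longrightarrow> (nx ^^ k) x0 \<noteq> x0" for k unfolding n_def using not_less_Least by blast
  define W where "W = map (\<lambda>i. (nx ^^ i) x0) [0..<n]"
  have dW: "distinct W"
    unfolding W_def distinct_map
    by (auto intro!: inj_onI inj simp: nmin)
  have sW: "set W = P"
  proof
    show "set W \<subseteq> P" unfolding W_def using inP by auto
    show "P \<subseteq> set W"
    proof
      fix x assume "x \<in> P"
      then obtain i where "x = (nx ^^ i) x0" using reach by blast
      also have "\<dots> = (nx ^^ (i mod n)) x0" by (rule sym, rule funpow_mod_eq[OF n(2)])
      finally show "x \<in> set W" unfolding W_def using n(1) by auto
    qed
  qed
  have fol: "nx x = y" if fl: "follows W x y" for x y
  proof -
    obtain A B where AB: "W = A @ x # B" "y = hd (B @ A @ [x])"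
      using fl unfolding follows_def by blast
    define i where "i = length A"
    have len: "length W = n" by (simp add: W_def)
    have Wi: "W ! k = (nx ^^ k) x0" if "k < n" for k using that by (simp add: W_def)
    have xi: "x = (nx ^^ i) x0" "i < n" using AB(1) Wi[of i] len unfolding i_def by auto
    show ?thesis
    proof (cases "B = []")
      case False
      then have "y = W ! Suc i" using AB unfolding i_def by (simp add: nth_append hd_conv_nth)
      moreover have "Suc i < n" using False AB len unfolding i_def by (cases B) auto
      ultimately show ?thesis using xi Wi by simp
    next
      case True
      then have "Suc i = n" using AB len i_def by simp
      moreover have "y = hd W" using AB True by (cases A) auto
      then have "y = x0" using n Wi[of 0] len by (simp add: hd_conv_nth W_def)
      ultimately show ?thesis using xi n(2) by (metis funpow.simps(2) o_apply)
    qed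
  qed
  have "reads D W" unfolding reads_def gauss_word_def
  proof (intro conjI allI impI)
    show "distinct W" by (rule dW)
    show "W \<noteq> []" using n by (simp add: W_def)
    have f: "fst ` P = verts D" unfolding P_def not_outgoing_slots by force
    show "\<exists>V. set W = V \<times> {SW, SE}" unfolding sW P_def not_outgoing_slots by blast
    show "verts D = fst ` set W" using f sW by simp
    show "bij_betw (arc_to D) (set W) (arcs D)" using inb sW by simp
    show "arc_from D x = arc_to D y" if "follows W x y" for x y
      using fol[OF that] nx_arc[of x] follows_in[OF that] sW by auto
  qed
  then show ?thesis by blast
qed

section \<open>Erasing crossings\<close>

definition without :: "nat set \<Rightarrow> (nat \<times> slot) list \<Rightarrow> (nat \<times> slot) list" where
  [simp]: "without S W = filter (\<lambda>x. fst x \<notin> S) W"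

lemma first_kept_chain:
  assumes r: "reads E W" and k: "without S W \<noteq> []" and x: "x \<in> set W"
  shows "(arc_to E x, arc_to E (first_kept (\<lambda>x. fst x \<notin> S) W x)) \<in> (steps E S)\<^sup>*"
proof -
  obtain A B where W: "W = A @ x # B" using x by (meson split_list)
  have k': "\<exists>y\<in>set W. fst y \<notin> S" using k by (auto simp: filter_empty_conv)
  have r': "reads E (x # B @ A)" using reads_rotate[of E A "x # B"] r W by simp
  have "\<exists>y\<in>set (x # B @ A). fst y \<notin> S" using k' W by auto
  then obtain C z R where C: "x # B @ A = C @ z # R" "fst z \<notin> S" "\<forall>y\<in>set C. \<not> fst y \<notin> S"
    by (rule split_list_first_propE)
  have d: "distinct W" using reads_word[OF r] by (simp add: gauss_word_def)
  have "first_kept (\<lambda>x. fst x \<notin> S) W x = hd (without S (x # B @ A))"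
    using first_kept_eq[of A x B "\<lambda>x. fst x \<notin> S"] d k' unfolding W without_def by blast
  also have "\<dots> = z" unfolding C(1) using C(2,3) by simp
  finally have z: "first_kept (\<lambda>x. fst x \<notin> S) W x = z" .
  have hx: "hd (C @ [z]) = x" using C(1) by (cases C) auto
  show ?thesis unfolding z
    using reads_chain[of E "[]" C z R S] r' C hx by auto
qed

lemma gauss_word_without:
  assumes "gauss_word W" "without S W \<noteq> []" shows "gauss_word (without S W)"
proof -
  obtain V where V: "set W = V \<times> {SW, SE}" using assms(1) unfolding gauss_word_def by blast
  have "set (without S W) = (V - S) \<times> {SW, SE}"
  proof (rule set_eqI)
    fix x show "x \<in> set (without S W) \<longleftrightarrow> x \<in> (V - S) \<times> {SW, SE}"
      unfolding without_def set_filter V mem_Collect_eq mem_Times_iff Diff_iff by blast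
  qed
  moreover have "distinct (without S W)" using assms(1) by (simp add: gauss_word_def)
  ultimately show ?thesis unfolding gauss_word_def using assms(2) by blast
qed

text \<open>
  Letters that are not erased keep their arcs, and the other arcs are merged into them as
  described by \<open>first_kept\<close>.
\<close>

lemma reads_erase:
  assumes r: "reads E W" and k: "without S W \<noteq> []" and e: "erase E S q D" and D: "is_diagram D"
  shows "reads D (without S W)"
    and "x \<in> set W \<Longrightarrow> q (arc_to E x) = arc_to D (first_kept (\<lambda>x. fst x \<notin> S) W x)"
proof -
  let ?K = "\<lambda>x. fst x \<notin> S"
  have k': "\<exists>y\<in>set W. ?K y" using k by (auto simp: filter_empty_conv)
  have vD: "verts D = fst ` set (without S W)"
    using e reads_verts[OF r] unfolding erase_def by auto
  have w: "gauss_word (without S W)" by (rule gauss_word_without[OF reads_word[OF r] k])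
  have d: "distinct W" using reads_word[OF r] by (simp add: gauss_word_def)
  have arcE: "x \<in> set W \<Longrightarrow> arc_to E x \<in> arcs E" for x using bij_betw_apply[OF reads_arcs[OF r]] .
  have q: "q (arc_to E x) = arc_to D (first_kept ?K W x)" if "x \<in> set W" for x
  proof -
    let ?z = "first_kept ?K W x"
    have z: "?z \<in> set W" "?K ?z" using first_kept_in[OF k'] by auto
    have "(arc_to E x, arc_to E ?z) \<in> (steps E S \<union> (steps E S)\<inverse>)\<^sup>*"
      using first_kept_chain[OF r k that] by (rule subsetD[OF rtrancl_mono, rotated]) simp
    then have "q (arc_to E x) = q (arc_to E ?z)"
      using e arcE[OF that] arcE[OF z(1)] unfolding erase_def by blast
    also have "fst ?z \<in> verts D" unfolding vD using z by auto
    then have "q (arc_to E ?z) = arc_to D ?z" using e unfolding erase_def by simp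
    finally show ?thesis .
  qed
  then show "x \<in> set W \<Longrightarrow> q (arc_to E x) = arc_to D (first_kept ?K W x)" .
  have "set (without S W) \<noteq> {}" using k by (simp only: set_empty not_False_eq_True)
  then have ne: "verts D \<noteq> {}" unfolding vD by (simp only: image_is_empty not_False_eq_True)
  have sw: "set (without S W) = verts D \<times> {s. \<not> outgoing s}"
    unfolding vD not_outgoing_slots by (rule gauss_word_set[OF w])
  show "reads D (without S W)" unfolding reads_def
  proof (intro conjI allI impI w vD)
    show "bij_betw (arc_to D) (set (without S W)) (arcs D)"
      unfolding sw using D ne unfolding is_diagram_def by (simp add: case_prod_unfold)
    fix x z assume f: "follows (without S W) x z"
    have x: "x \<in> set W" "fst x \<notin> S" using follows_in[OF f] by auto
    obtain y where y: "y \<in> set W" "follows W x y" using follows_ex[OF x(1)] by blast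
    have "fst x \<in> verts D" unfolding vD using x by auto
    then have "arc_from D x = q (arc_from E x)" using e unfolding erase_def by simp
    also have "\<dots> = q (arc_to E y)" using reads_follows[OF r y(2)] by simp
    also have "\<dots> = arc_to D (first_kept ?K W y)" by (rule q[OF y(1)])
    also have "first_kept ?K W y = z"
      using follows_filter[OF d _ y(2) f[unfolded without_def]] x by simp
    finally show "arc_from D x = arc_to D z" .
  qed
qed

text \<open>
  Conversely, a diagram that reads the shortened word arises by erasing crossings. Both ends of
  an erased passage have the same first kept letter, so the merging identifies no more arcs than
  the erased crossings connect.
\<close>

lemma erase_reads:
  assumes r: "reads E W" and S: "S \<subseteq> verts E" and rD: "reads D (without S W)"
    and u: "\<And>v. v \<in> verts D \<Longrightarrow> up_right_over D v = up_right_over E v"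
  shows "\<exists>q. erase E S q D \<and> (\<forall>x\<in>set W. q (arc_to E x) = arc_to D (first_kept (\<lambda>x. fst x \<notin> S) W x))"
proof -
  let ?K = "\<lambda>x. fst x \<notin> S"
  let ?f = "first_kept ?K W"
  have k: "without S W \<noteq> []" using reads_word[OF rD] by (simp add: gauss_word_def)
  then have k': "\<exists>y\<in>set W. ?K y" by (auto simp: filter_empty_conv)
  have d: "distinct W" using reads_word[OF r] by (simp add: gauss_word_def)
  define q where "q = (\<lambda>a. arc_to D (?f (inv_into (set W) (arc_to E) a)))"
  have injE: "inj_on (arc_to E) (set W)" using reads_arcs[OF r] by (simp add: bij_betw_def)
  have arcsE: "arcs E = arc_to E ` set W" using reads_arcs[OF r] by (simp add: bij_betw_def)
  have injD: "inj_on (arc_to D) (set (without S W))" using reads_arcs[OF rD]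
    by (simp add: bij_betw_def)
  have arcsD: "arcs D = arc_to D ` set (without S W)" using reads_arcs[OF rD]
    by (simp add: bij_betw_def)
  have q: "q (arc_to E x) = arc_to D (?f x)" if "x \<in> set W" for x
    unfolding q_def using inv_into_f_f[OF injE that] by simp
  have fin: "?f x \<in> set (without S W)" for x unfolding without_def by (rule first_kept_in[OF k'])
  have fsame: "?f x = x" if "x \<in> set (without S W)" for x
    using that by (intro first_kept_same) auto
  have "erase E S q D" unfolding erase_def
  proof (intro conjI ballI allI)
    show "verts D = verts E - S" using reads_verts[OF r] reads_verts[OF rD] by auto
    show "arcs D = q ` arcs E"
    proof
      show "arcs D \<subseteq> q ` arcs E"
      proof
        fix a assume "a \<in> arcs D"
        then obtain x where x: "x \<in> set (without S W)" "a = arc_to D x" unfolding arcsD by blast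
        then have "a = q (arc_to E x)" using q[of x] fsame by simp
        then show "a \<in> q ` arcs E" unfolding arcsE using x by auto
      qed
      show "q ` arcs E \<subseteq> arcs D" unfolding arcsE arcsD
      proof clarify
        fix v s assume vs: "(v, s) \<in> set W"
        show "q (arc_to E (v, s)) \<in> arc_to D ` set (without S W)"
          unfolding q[OF vs] by (rule imageI[OF fin])
      qed
    qed
  next
    fix a b assume "a \<in> arcs E" "b \<in> arcs E"
    then obtain x y where x: "x \<in> set W" "a = arc_to E x" and y: "y \<in> set W" "b = arc_to E y"
      unfolding arcsE by blast
    show "(q a = q b) = ((a, b) \<in> (steps E S \<union> (steps E S)\<inverse>)\<^sup>*)"
    proof
      assume "q a = q b"
      then have "arc_to D (?f x) = arc_to D (?f y)" using x y q by simp
      then have eq: "?f x = ?f y" using inj_onD[OF injD _ fin fin] by blast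
      have "(a, arc_to E (?f x)) \<in> (steps E S)\<^sup>*" "(b, arc_to E (?f x)) \<in> (steps E S)\<^sup>*"
        using first_kept_chain[OF r k x(1)] first_kept_chain[OF r k y(1)] x y eq by simp_all
      then have "(a, arc_to E (?f x)) \<in> (steps E S)\<^sup>*" "(arc_to E (?f x), b) \<in> ((steps E S)\<inverse>)\<^sup>*"
        by (simp_all only: rtrancl_converse converse_iff)
      then have "(a, arc_to E (?f x)) \<in> (steps E S \<union> (steps E S)\<inverse>)\<^sup>*"
        "(arc_to E (?f x), b) \<in> (steps E S \<union> (steps E S)\<inverse>)\<^sup>*"
        by (meson Un_upper1 Un_upper2 rtrancl_mono subsetD)+
      then show "(a, b) \<in> (steps E S \<union> (steps E S)\<inverse>)\<^sup>*" by (rule rtrancl_trans)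
    next
      have st: "q c = q e" if ce: "(c, e) \<in> steps E S" for c e
      proof -
        obtain x y where xy: "follows W x y" "fst x \<in> S" "c = arc_to E x" "e = arc_to E y"
          using ce reads_steps_iff[OF r S] by blast
        have "?f x = ?f y" using first_kept_step[OF d k' _ xy(1)] xy(2) by simp
        then show ?thesis using q follows_in[OF xy(1)] xy(3,4) by simp
      qed
      assume "(a, b) \<in> (steps E S \<union> (steps E S)\<inverse>)\<^sup>*"
      then show "q a = q b"
        by (induction rule: rtrancl_induct) (auto dest: st)
    qed
  next
    fix v s assume v: "v \<in> verts D"
    have vs: "(v, t) \<in> set (without S W)" if "\<not> outgoing t" for t
      using v that reads_set[OF rD] by simp
    show "arc D v s = q (arc E v s)"
    proof (cases "outgoing s")
      case False
      then show ?thesis using q[of "(v, s)"] fsame[OF vs[OF False]] vs[OF False] by simp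
    next
      case True
      let ?x = "(v, opp s)"
      have x: "?x \<in> set (without S W)" by (rule vs) (simp add: True)
      then have x': "?x \<in> set W" "?K ?x" by auto
      obtain y where y: "y \<in> set W" "follows W ?x y" using follows_ex[OF x'(1)] by blast
      obtain z where z: "follows (without S W) ?x z" using follows_ex[OF x] by blast
      have "z = ?f y" by (rule follows_filter[OF d x'(2) y(2) z[unfolded without_def]])
      moreover have "arc D v s = arc_to D z" using reads_follows[OF rD z] by simp
      moreover have "arc E v s = arc_to E y" using reads_follows[OF r y(2)] by simp
      ultimately show ?thesis using q[OF y(1)] by simp
    qed
  next
    fix v assume "v \<in> verts D" then show "up_right_over D v = up_right_over E v" by (rule u)
  qed
  then show ?thesis using q by blast
qed

text \<open>
  A bigon whose two strands run through it in the same direction, from \<open>v\<close> to \<open>w\<close>. They change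
  sides at \<open>v\<close>, so the strand from SW at \<open>v\<close> comes from SE at \<open>w\<close>; it is on top at both or at
  neither exactly if \<open>up_right_over\<close> differs.
\<close>

lemma r2_north_south:
  assumes r: "reads E W" and rD: "reads D (without {v, w} W)"
    and f: "follows W (lft v) (rgt w)" "follows W (rgt v) (lft w)"
    and "v \<noteq> w" "up_right_over E v \<noteq> up_right_over E w"
    and u: "\<And>v. v \<in> verts D \<Longrightarrow> up_right_over D v = up_right_over E v"
  shows "\<exists>q. r2_move E (v, North) (w, South) q D \<and>
           (\<forall>x\<in>set W. q (arc_to E x) = arc_to D (first_kept (\<lambda>x. fst x \<notin> {v, w}) W x))"
proof -
  have vw: "{v, w} \<subseteq> verts E" using follows_in[OF f(1)] reads_verts[OF r] by force
  obtain q where q: "erase E {v, w} q D"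
    "\<forall>x\<in>set W. q (arc_to E x) = arc_to D (first_kept (\<lambda>x. fst x \<notin> {v, w}) W x)"
    using erase_reads[OF r vw rD u] by blast
  have "r2_move E (v, North) (w, South) q D" unfolding r2_move_def
    using reads_diagram[OF r] reads_diagram[OF rD] vw assms(5,6) q(1)
      reads_follows[OF r f(1)] reads_follows[OF r f(2)]
    by (auto simp: outgoing_def over_at_def)
  then show ?thesis using q(2) by blast
qed

text \<open>
  A bigon whose two strands run through it in opposite directions.
\<close>

lemma r2_west_west:
  assumes r: "reads E W" and rD: "reads D (without {v, w} W)"
    and f: "follows W (rgt v) (lft w)" "follows W (rgt w) (lft v)"
    and "v \<noteq> w" "up_right_over E v \<noteq> up_right_over E w"
    and u: "\<And>v. v \<in> verts D \<Longrightarrow> up_right_over D v = up_right_over E v"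
  shows "\<exists>q. r2_move E (v, West) (w, West) q D"
proof -
  have vw: "{v, w} \<subseteq> verts E" using follows_in[OF f(1)] reads_verts[OF r] by force
  obtain q where q: "erase E {v, w} q D"
    using erase_reads[OF r vw rD u] by blast
  have "r2_move E (v, West) (w, West) q D" unfolding r2_move_def
    using reads_diagram[OF r] reads_diagram[OF rD] vw assms(5,6) q(1)
      reads_follows[OF r f(1)] reads_follows[OF r f(2)]
    by (auto simp: outgoing_def over_at_def)
  then show ?thesis by blast
qed

lemma without_simps:
  "without S [] = []"
  "without S (x # W) = (if fst x \<in> S then without S W else x # without S W)"
  "without S (A @ B) = without S A @ without S B"
  "S \<inter> fst ` set W = {} \<Longrightarrow> without S W = W"
  by (auto intro!: filter_True)

lemma without_without: "without S (without T W) = without (S \<union> T) W"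
  by (simp add: conj_commute)

lemma set_without: "set (without S W) = {x \<in> set W. fst x \<notin> S}"
  by simp

lemma fst_set_without: "fst ` set (without S W) = fst ` set W - S"
  unfolding set_without by force

lemma follows_without:
  assumes "distinct W" "follows W x y" "fst x \<notin> S" "fst y \<notin> S"
  shows "follows (without S W) x y"
proof -
  have "x \<in> set (without S W)" using assms(3) follows_in[OF assms(2)] by simp
  from follows_ex[OF this] obtain z where z: "follows (without S W) x z" by blast
  have "z = first_kept (\<lambda>x. fst x \<notin> S) W y"
    using follows_filter[OF assms(1) _ assms(2) z[unfolded without_def]] assms(3) by simp
  also have "\<dots> = y" using follows_in[OF assms(2)] assms(4) by (intro first_kept_same) auto
  finally show ?thesis using z by simp
qed

declare without_def [simp del]

lemma without_nonempty: "without S W \<noteq> [] \<Longrightarrow> T \<subseteq> S \<Longrightarrow> without T W \<noteq> []"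
  by (auto simp: without_def filter_empty_conv)

section \<open>The diagram of a Gauss word\<close>

text \<open>
  Arcs of the diagram of a word are numbered by the passages at which they end.
\<close>

definition passage_arc :: "nat \<times> slot \<Rightarrow> nat" where
  "passage_arc x = 2 * fst x + (if snd x = SW then 0 else 1)"

definition word_diagram :: "(nat \<times> slot) list \<Rightarrow> (nat \<Rightarrow> bool) \<Rightarrow> diagram" where
  "word_diagram W u = \<lparr>verts = fst ` set W, arcs = passage_arc ` set W,
     arc = (\<lambda>v s. passage_arc (if outgoing s then THE y. follows W (v, opp s) y else (v, s))),
     up_right_over = u\<rparr>"

lemma word_diagram_sel[simp]:
  "verts (word_diagram W u) = fst ` set W" "up_right_over (word_diagram W u) = u"
  by (simp_all add: word_diagram_def)

lemma reads_word_diagram: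
  assumes w: "gauss_word W" shows "reads (word_diagram W u) W"
  unfolding reads_def
proof (intro conjI allI impI w)
  show "verts (word_diagram W u) = fst ` set W" by simp
  have o: "\<not> outgoing (snd x)" if "x \<in> set W" for x
    using that gauss_word_set[OF w] not_outgoing_slots(1) by (metis mem_Times_iff mem_Collect_eq)
  have to: "arc_to (word_diagram W u) x = passage_arc x" if "x \<in> set W" for x
    using o[OF that] by (simp add: word_diagram_def)
  have "inj_on passage_arc (set W)"
  proof (rule inj_onI)
    fix x y assume x: "x \<in> set W" and y: "y \<in> set W" and eq: "passage_arc x = passage_arc y"
    have "snd x \<in> {SW, SE}" "snd y \<in> {SW, SE}" using x y gauss_word_set[OF w]
      by (metis mem_Times_iff)+
    then show "x = y" using eq unfolding passage_arc_def
      by (cases x; cases y) (auto split: if_splits; presburger)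
  qed
  then have "bij_betw passage_arc (set W) (arcs (word_diagram W u))"
    by (simp add: bij_betw_def word_diagram_def)
  then show "bij_betw (arc_to (word_diagram W u)) (set W) (arcs (word_diagram W u))"
    by (rule iffD2[OF bij_betw_cong, rotated]) (rule to)
  fix x y assume f: "follows W x y"
  have "(THE z. follows W x z) = y"
    using f by (rule the_equality) (rule follows_unique[OF _ _ f], use w in \<open>simp add:
      gauss_word_def\<close>)
  then have "arc_from (word_diagram W u) x = passage_arc y"
    using o[of x] follows_in[OF f] by (simp add: word_diagram_def)
  then show "arc_from (word_diagram W u) x = arc_to (word_diagram W u) y"
    using to follows_in[OF f] by simp
qed

text \<open>
  Matching the arcs that end at the same passages.
\<close>

lemma iso_move_reads:
  assumes r: "reads D W" and r': "reads D' W"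
    and u: "\<And>v. v \<in> verts D \<Longrightarrow> up_right_over D' v = up_right_over D v"
  shows "\<exists>g. iso_move D D' id g"
proof -
  define g where "g = (\<lambda>a. arc_to D' (inv_into (set W) (arc_to D) a))"
  have inj: "inj_on (arc_to D) (set W)" using reads_arcs[OF r] by (simp add: bij_betw_def)
  have g: "g (arc_to D x) = arc_to D' x" if "x \<in> set W" for x
    unfolding g_def using inv_into_f_f[OF inj that] by simp
  have "bij_betw (arc_to D' \<circ> inv_into (set W) (arc_to D)) (arcs D) (arcs D')"
    by (rule bij_betw_trans[OF bij_betw_inv_into[OF reads_arcs[OF r]] reads_arcs[OF r']])
  then have gb: "bij_betw g (arcs D) (arcs D')" by (simp add: g_def o_def)
  have "arc D' v s = g (arc D v s)" if v: "v \<in> verts D" for v s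
  proof (cases "outgoing s")
    case False
    then have "(v, s) \<in> set W" using v reads_set[OF r] by simp
    then show ?thesis using g[of "(v, s)"] by simp
  next
    case True
    then have x: "(v, opp s) \<in> set W" using v reads_set[OF r] by simp
    obtain y where y: "y \<in> set W" "follows W (v, opp s) y" using follows_ex[OF x] by blast
    show ?thesis using reads_follows[OF r y(2)] reads_follows[OF r' y(2)] g[OF y(1)] by simp
  qed
  then have "iso_move D D' id g" unfolding iso_move_def
    using reads_diagram[OF r] reads_diagram[OF r'] gb u reads_verts[OF r] reads_verts[OF r'] by simp
  then show ?thesis by blast
qed

section \<open>Third moves exchange letters\<close>

text \<open>
  A third move makes each of its three strands pass its two crossings in the opposite order: in
  the word, two adjacent letters are exchanged in three places. This is the same as renaming all
  letters by an involution \<open>\<sigma>\<close> while the arcs stay in their places, so that the result is again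
  a diagram for free.
\<close>

definition relabel :: "(nat \<times> slot \<Rightarrow> nat \<times> slot) \<Rightarrow> diagram \<Rightarrow> diagram" where
  "relabel \<sigma> D = D\<lparr>arc := \<lambda>v s.
     if outgoing s then arc_from D (\<sigma> (v, opp s)) else arc_to D (\<sigma> (v, s))\<rparr>"

lemma relabel_sel[simp]: "verts (relabel \<sigma> D) = verts D" "arcs (relabel \<sigma> D) = arcs D"
  "up_right_over (relabel \<sigma> D) = up_right_over D"
  by (simp_all add: relabel_def)

lemma reads_relabel:
  assumes r: "reads D W" and inv: "\<And>x. \<sigma> (\<sigma> x) = x" and s: "\<And>x. x \<in> set W \<Longrightarrow> \<sigma> x \<in> set W"
  shows "reads (relabel \<sigma> D) (map \<sigma> W)"
proof -
  have inj: "inj_on \<sigma> (set W)" using inv by (metis inj_onI)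
  have img: "\<sigma> ` set W = set W" using s inv
    by (metis (no_types, opaque_lifting) image_iff subsetI subset_antisym image_subset_iff)
  have w: "gauss_word (map \<sigma> W)" using reads_word[OF r] inj unfolding gauss_word_def
    by (simp add: distinct_map img)
  have o: "\<not> outgoing (snd x)" if "x \<in> set W" for x
    using that reads_set[OF r] by (metis mem_Times_iff mem_Collect_eq)
  have to: "arc_to (relabel \<sigma> D) x = arc_to D (\<sigma> x)" if "x \<in> set W" for x
    using o[OF that] by (simp add: relabel_def)
  have fr: "arc_from (relabel \<sigma> D) x = arc_from D (\<sigma> x)" if "x \<in> set W" for x
    using o[OF that] by (simp add: relabel_def)
  show ?thesis unfolding reads_def
  proof (intro conjI allI impI w)
    show "verts (relabel \<sigma> D) = fst ` set (map \<sigma> W)" using img reads_verts[OF r] by simp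
    have "bij_betw \<sigma> (set W) (set W)" using inj img by (simp add: bij_betw_def)
    then have "bij_betw (arc_to D \<circ> \<sigma>) (set W) (arcs D)"
      by (rule bij_betw_trans[OF _ reads_arcs[OF r]])
    then have "bij_betw (arc_to (relabel \<sigma> D)) (set W) (arcs D)"
      by (rule iffD2[OF bij_betw_cong, rotated]) (simp add: to)
    then show "bij_betw (arc_to (relabel \<sigma> D)) (set (map \<sigma> W)) (arcs (relabel \<sigma> D))"
      by (simp add: img)
    fix x y assume f: "follows (map \<sigma> W) x y"
    have "map \<sigma> (map \<sigma> W) = W" using inv by (simp add: map_idI)
    then have f': "follows W (\<sigma> x) (\<sigma> y)" using follows_map[OF f, of \<sigma>] by simp
    have "x \<in> set W" "y \<in> set W" using follows_in[OF f] img by auto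
    then show "arc_from (relabel \<sigma> D) x = arc_to (relabel \<sigma> D) y"
      using fr to reads_follows[OF r f'] by simp
  qed
qed

definition swap_passages :: "'b \<Rightarrow> 'b \<Rightarrow> 'b \<Rightarrow> 'b \<Rightarrow> 'b \<Rightarrow> 'b \<Rightarrow> 'b \<Rightarrow> 'b" where
  "swap_passages a b c d e f x = (if x = a then b else if x = b then a else if x = c then d
     else if x = d then c else if x = e then f else if x = f then e else x)"

text \<open>
  The triangle lies east of \<open>e\<close>, north of \<open>n\<close> and south of \<open>s\<close>, and its sides are the three
  pairs of consecutive letters. The last hypothesis says that some side is level.
\<close>

lemma r3_east:
  assumes r: "reads D W" and d: "distinct [e, n, s]"
    and f: "follows W (rgt n) (rgt e)" "follows W (lft n) (rgt s)" "follows W (lft e) (lft s)"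
    and l: "up_right_over D e = up_right_over D n \<or> up_right_over D n \<noteq> up_right_over D s \<or>
        up_right_over D s = up_right_over D e"
  shows "\<exists>D'. r3_move D (e, East) (n, North) (s, South) D'"
proof -
  let ?\<sigma> = "swap_passages (rgt n) (rgt e) (lft n) (rgt s) (lft e) (lft s)"
  let ?D = "relabel ?\<sigma> D"
  have "reads ?D (map ?\<sigma> W)"
  proof (rule reads_relabel[OF r])
    show "?\<sigma> (?\<sigma> x) = x" for x using d by (auto simp: swap_passages_def)
    show "?\<sigma> x \<in> set W" if "x \<in> set W" for x
      using that follows_in[OF f(1)] follows_in[OF f(2)] follows_in[OF f(3)]
        by (auto simp: swap_passages_def)
  qed
  then have di: "is_diagram ?D" by (rule reads_diagram)
  note fol = reads_follows[OF r f(1)] reads_follows[OF r f(2)] reads_follows[OF r f(3)]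
  have vs: "{e, n, s} \<subseteq> verts D"
    using follows_in[OF f(1)] follows_in[OF f(2)] reads_verts[OF r] by force
  have "arc ?D v = arc D v" if "v \<in> verts D - {e, n, s}" for v
    using that by (auto simp: relabel_def swap_passages_def)
  moreover have "r3_vertex D ?D (s, South) (e, East) (n, North)"
    "r3_vertex D ?D (e, East) (n, North) (s, South)"
    "r3_vertex D ?D (n, North) (s, South) (e, East)"
    using d fol by (auto simp: relabel_def swap_passages_def outgoing_def)
  ultimately have "r3_move D (e, East) (n, North) (s, South) ?D" unfolding r3_move_def
    using reads_diagram[OF r] di vs d fol l by (auto simp: outgoing_def over_at_def)
  then show ?thesis by blast
qed

text \<open>
  The mirror image of \<open>r3_east\<close>, with the triangle west of \<open>w\<close>, south of \<open>y\<close> and north of \<open>z\<close>.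
\<close>

lemma r3_west:
  assumes r: "reads D W" and d: "distinct [w, y, z]"
    and f: "follows W (rgt w) (rgt y)" "follows W (rgt z) (lft y)" "follows W (lft z) (lft w)"
    and l: "up_right_over D w = up_right_over D y \<or> up_right_over D y \<noteq> up_right_over D z \<or>
        up_right_over D z = up_right_over D w"
  shows "\<exists>D'. r3_move D (w, West) (y, South) (z, North) D'"
proof -
  let ?\<sigma> = "swap_passages (rgt w) (rgt y) (rgt z) (lft y) (lft z) (lft w)"
  let ?D = "relabel ?\<sigma> D"
  have "reads ?D (map ?\<sigma> W)"
  proof (rule reads_relabel[OF r])
    show "?\<sigma> (?\<sigma> x) = x" for x using d by (auto simp: swap_passages_def)
    show "?\<sigma> x \<in> set W" if "x \<in> set W" for x
      using that follows_in[OF f(1)] follows_in[OF f(2)] follows_in[OF f(3)]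
        by (auto simp: swap_passages_def)
  qed
  then have di: "is_diagram ?D" by (rule reads_diagram)
  note fol = reads_follows[OF r f(1)] reads_follows[OF r f(2)] reads_follows[OF r f(3)]
  have vs: "{w, y, z} \<subseteq> verts D"
    using follows_in[OF f(1)] follows_in[OF f(2)] reads_verts[OF r] by force
  have "arc ?D v = arc D v" if "v \<in> verts D - {w, y, z}" for v
    using that by (auto simp: relabel_def swap_passages_def)
  moreover have "r3_vertex D ?D (z, North) (w, West) (y, South)"
    "r3_vertex D ?D (w, West) (y, South) (z, North)"
    "r3_vertex D ?D (y, South) (z, North) (w, West)"
    using d fol by (auto simp: relabel_def swap_passages_def outgoing_def)
  ultimately have "r3_move D (w, West) (y, South) (z, North) ?D" unfolding r3_move_def
    using reads_diagram[OF r] di vs d fol l by (auto simp: outgoing_def over_at_def)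
  then show ?thesis by blast
qed

section \<open>Parities on Gauss words\<close>

text \<open>
  The two alternatives are the bigon with parallel strands and the one with antiparallel
  strands.
\<close>

definition cancelling :: "(nat \<Rightarrow> bool) \<Rightarrow> (nat \<times> slot) list \<Rightarrow> nat \<Rightarrow> nat \<Rightarrow> bool" where
  "cancelling u W v w \<longleftrightarrow> v \<noteq> w \<and> u v \<noteq> u w \<and>
     (follows W (lft v) (rgt w) \<and> follows W (rgt v) (lft w) \<or>
      follows W (rgt v) (lft w) \<and> follows W (rgt w) (lft v))"

lemma cancelling_parallel:
  "v \<noteq> w \<Longrightarrow> u v \<noteq> u w \<Longrightarrow> adjacent W (lft v) (rgt w) \<Longrightarrow> adjacent W (rgt v) (lft w) \<Longrightarrow> cancelling u W v w"
  by (simp add: cancelling_def adjacent_follows)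

lemma cancelling_antiparallel:
  "v \<noteq> w \<Longrightarrow> u v \<noteq> u w \<Longrightarrow> adjacent W (rgt v) (lft w) \<Longrightarrow> adjacent W (rgt w) (lft v) \<Longrightarrow> cancelling u W v w"
  by (simp add: cancelling_def adjacent_follows)

text \<open>
  Erasing other crossings does not separate the letters of a pair. Hence pairs can be cancelled
  in any order.
\<close>

lemma cancelling_without:
  assumes "distinct W" "cancelling u W v w" "v \<notin> S" "w \<notin> S"
  shows "cancelling u (without S W) v w"
  using assms(2-) unfolding cancelling_def by (auto intro: follows_without[OF assms(1)])

lemma cancelling_in: "cancelling u W v w \<Longrightarrow> v \<in> fst ` set W \<and> w \<in> fst ` set W"
  unfolding cancelling_def using follows_in by force

lemma cancelling_r2_move:
  assumes W: "gauss_word W" and W': "without {v, w} W \<noteq> []" and c: "cancelling u W v w"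
  shows "\<exists>x y q. fst x = v \<and> fst y = w \<and>
    r2_move (word_diagram W u) x y q (word_diagram (without {v, w} W) u)"
proof -
  note r = reads_word_diagram[OF W, of u] reads_word_diagram[OF gauss_word_without[OF W W'], of u]
  have vw: "v \<noteq> w" "up_right_over (word_diagram W u) v \<noteq> up_right_over (word_diagram W u) w"
    using c by (auto simp: cancelling_def)
  from c consider (par) "follows W (lft v) (rgt w)" "follows W (rgt v) (lft w)"
    | (anti) "follows W (rgt v) (lft w)" "follows W (rgt w) (lft v)"
    unfolding cancelling_def by blast
  then show ?thesis
  proof cases
    case par
    have "\<exists>q. r2_move (word_diagram W u) (v, North) (w, South) q (word_diagram (without {v, w} W)
      u)"
      using r2_north_south[OF r par vw] by auto
    then show ?thesis by (metis fst_conv)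
  next
    case anti
    have "\<exists>q. r2_move (word_diagram W u) (v, West) (w, West) q (word_diagram (without {v, w} W) u)"
      using r2_west_west[OF r anti vw] by auto
    then show ?thesis by (metis fst_conv)
  qed
qed

definition pair_names :: "(nat \<times> nat) list \<Rightarrow> nat list" where
  "pair_names ps = concat (map (\<lambda>(v, w). [v, w]) ps)"

lemma pair_names_simps[simp]: "pair_names [] = []"
  "pair_names ((v, w) # ps) = v # w # pair_names ps"
  by (simp_all add: pair_names_def)

text \<open>
  The set of all diagrams of a virtual knot has this property.
\<close>

locale move_closed =
  fixes K :: "diagram set"
  assumes closed: "D \<in> K \<Longrightarrow> move D D' F C \<Longrightarrow> D' \<in> K"

context move_closed begin

lemma move_in_iff: "move D D' F C \<Longrightarrow> D \<in> K \<longleftrightarrow> D' \<in> K"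
  using closed move.inverse by blast

abbreviation in_K :: "(nat \<times> slot) list \<Rightarrow> (nat \<Rightarrow> bool) \<Rightarrow> bool" where
  "in_K W u \<equiv> word_diagram W u \<in> K"

end

locale parity_on = move_closed K for K +
  fixes p :: "diagram \<Rightarrow> nat \<Rightarrow> 'a::ab_group_add"
  assumes parity: "oriented_parity K p"

context parity_on begin

lemma p_move: "D \<in> K \<Longrightarrow> move D D' F C \<Longrightarrow> (v, v') \<in> F \<Longrightarrow> p D v = p D' v'"
  using parity unfolding oriented_parity_def by blast

lemma p_r2: 
  assumes "r2_move E x y q D" "E \<in> K \<or> D \<in> K"
  shows "E \<in> K" "D \<in> K" "p E (fst x) + p E (fst y) = 0" "v \<in> verts D \<Longrightarrow> p E v = p D v"
proof -
  note m = move.r2[OF assms(1)]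
  show E: "E \<in> K" and "D \<in> K" using assms(2) move_in_iff[OF m] by auto
  show "p E (fst x) + p E (fst y) = 0"
    using parity E assms(1) unfolding oriented_parity_def by blast
  show "p E v = p D v" if "v \<in> verts D" using p_move[OF E m] that by (simp add: Id_on_iff)
qed

lemma p_r3:
  assumes "D \<in> K" "r3_move D x y z D'"
  shows "corner_sign (snd x) (p D (fst x)) + corner_sign (snd y) (p D (fst y))
        + corner_sign (snd z) (p D (fst z)) = 0"
  using parity assms unfolding oriented_parity_def by blast

lemma p_reads:
  assumes "D \<in> K" "reads D W" "reads D' W"
    "\<And>v. v \<in> verts D \<Longrightarrow> up_right_over D' v = up_right_over D v"
  shows "D' \<in> K" "v \<in> verts D \<Longrightarrow> p D' v = p D v"
proof -
  obtain g where g: "iso_move D D' id g" using iso_move_reads[OF assms(2,3,4)] by blast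
  note m = move.iso[OF g]
  show "D' \<in> K" using closed[OF assms(1) m] .
  show "p D' v = p D v" if "v \<in> verts D" using p_move[OF assms(1) m, of v v] that by simp
qed

text \<open>
  The parity as a function of Gauss words, with \<open>u\<close> choosing the upper strands. By \<open>val_cong\<close>,
  \<open>val_rotate\<close> and \<open>val_reads\<close> only the cyclic word and the values of \<open>u\<close> on its crossings
  matter.
\<close>

definition val :: "(nat \<times> slot) list \<Rightarrow> (nat \<Rightarrow> bool) \<Rightarrow> nat \<Rightarrow> 'a" where
  "val W u v = p (word_diagram W u) v"

lemma val_cong:
  assumes "gauss_word W" "in_K W u" "\<And>v. v \<in> fst ` set W \<Longrightarrow> u' v = u v"
  shows "in_K W u'" "v \<in> fst ` set W \<Longrightarrow> val W u' v = val W u v"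
  using p_reads[OF assms(2) reads_word_diagram[OF assms(1)] reads_word_diagram[OF assms(1)], of
    u'] assms(3)
  unfolding val_def by auto

lemma val_rotate:
  assumes "gauss_word (A @ B)" "in_K (A @ B) u"
  shows "in_K (B @ A) u" "v \<in> fst ` set (A @ B) \<Longrightarrow> val (B @ A) u v = val (A @ B) u v"
proof -
  have r: "reads (word_diagram (B @ A) u) (A @ B)"
    by (rule reads_rotate) (rule reads_word_diagram[OF gauss_word_rotate[OF assms(1)]])
  note * = p_reads[OF assms(2) reads_word_diagram[OF assms(1)] r]
  show "in_K (B @ A) u" by (rule *(1)) simp
  show "val (B @ A) u v = val (A @ B) u v" if "v \<in> fst ` set (A @ B)"
    unfolding val_def by (rule *(2)) (use that in simp_all)
qed

lemma val_reads:
  assumes "D \<in> K" "reads D W" "\<And>v. v \<in> verts D \<Longrightarrow> u v = up_right_over D v"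
  shows "in_K W u" "v \<in> verts D \<Longrightarrow> p D v = val W u v"
  using p_reads[OF assms(1,2) reads_word_diagram[OF reads_word[OF assms(2)]], of u] assms(3)
  unfolding val_def by auto

lemma in_K_reads:
  assumes "D \<in> K" "reads D W" shows "in_K W (up_right_over D)"
  using val_reads(1)[OF assms] by blast

lemma val_cancelling:
  assumes W: "gauss_word W" and W': "without {v, w} W \<noteq> []" and c: "cancelling u W v w"
    and K: "in_K W u \<or> in_K (without {v, w} W) u"
  shows "in_K W u" "in_K (without {v, w} W) u" "val W u w = - val W u v"
    "z \<in> fst ` set (without {v, w} W) \<Longrightarrow> val W u z = val (without {v, w} W) u z"
proof -
  obtain x y q where q: "fst x = v" "fst y = w"
    "r2_move (word_diagram W u) x y q (word_diagram (without {v, w} W) u)"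
    using cancelling_r2_move[OF W W' c] by blast
  note r = p_r2[OF q(3) K]
  show "in_K W u" "in_K (without {v, w} W) u" by (rule r)+
  show "val W u w = - val W u v" using r(3) q by (simp add: val_def add_eq_0_iff add.commute)
  show "val W u z = val (without {v, w} W) u z" if "z \<in> fst ` set (without {v, w} W)"
    using r(4)[of z] that by (simp add: val_def)
qed

lemma val_cancel_pairs:
  assumes "gauss_word W" "\<And>v w. (v, w) \<in> set ps \<Longrightarrow> cancelling u W v w" "distinct (pair_names ps)"
    "without (set (pair_names ps)) W = W'" "W' \<noteq> []"
  shows "(in_K W u \<longleftrightarrow> in_K W' u) \<and>
    (in_K W u \<longrightarrow> (\<forall>z \<in> fst ` set W'. val W u z = val W' u z))"
  using assms
proof (induction ps arbitrary: W)
  case Nil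
  then show ?case by (simp add: without_def)
next
  case (Cons vw ps)
  obtain v w where vw: "vw = (v, w)" by (cases vw)
  let ?W = "without {v, w} W"
  have W': "without (set (pair_names ps)) ?W = W'"
    using Cons.prems(4) by (simp add: without_without vw Un_commute insert_commute)
  have ne: "?W \<noteq> []" using W' Cons.prems(5) without_simps(1) by metis
  have d: "distinct W" using Cons.prems(1) by (simp add: gauss_word_def)
  have c: "cancelling u W v w" using Cons.prems(2) vw by simp
  have g: "gauss_word ?W" by (rule gauss_word_without[OF Cons.prems(1) ne])
  have IH: "(in_K ?W u \<longleftrightarrow> in_K W' u) \<and> (in_K ?W u \<longrightarrow> (\<forall>z \<in> fst ` set W'. val ?W u z = val W' u z))"
  proof (rule Cons.IH[OF g _ _ W' Cons.prems(5)])
    show "distinct (pair_names ps)" using Cons.prems(3) vw by simp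
    fix a b assume ab: "(a, b) \<in> set ps"
    then have "a \<in> set (pair_names ps)" "b \<in> set (pair_names ps)" by (force simp: pair_names_def)+
    then have n: "a \<notin> {v, w}" "b \<notin> {v, w}" using Cons.prems(3) vw by auto
    have "cancelling u W a b" using Cons.prems(2) ab by simp
    then show "cancelling u ?W a b" by (rule cancelling_without[OF d _ n])
  qed
  have sub: "fst ` set W' \<subseteq> fst ` set ?W" using W' by (auto simp: set_without)
  have i: "in_K W u \<longleftrightarrow> in_K ?W u" using val_cancelling(1,2)[OF Cons.prems(1) ne c] by blast
  have "val W u z = val W' u z" if "in_K W u" "z \<in> fst ` set W'" for z
  proof -
    have "val W u z = val ?W u z"
      by (rule val_cancelling(4)[OF Cons.prems(1) ne c disjI1[OF that(1)] subsetD[OF sub that(2)]])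
    also have "\<dots> = val W' u z" using IH i that by blast
    finally show ?thesis .
  qed
  then show ?case using IH i by blast
qed

text \<open>
  The form in which invariance under second moves is used: an auxiliary word is shortened to the
  word that defines the value in question, by cancelling the pairs that belong to the other
  strands.
\<close>

lemma val_remove:
  assumes "gauss_word W" "in_K W u" "\<And>v w. (v, w) \<in> set ps \<Longrightarrow> cancelling u W v w"
    "distinct (pair_names ps)"
    "without (set (pair_names ps)) W = W'" "z \<in> fst ` set W'"
  shows "val W u z = val W' u z"
proof -
  have "W' \<noteq> []" using assms(6) by auto
  then show ?thesis using val_cancel_pairs[OF assms(1,3,4,5)] assms(2,6) by blast
qed

lemma in_K_insert:
  assumes "gauss_word W" "in_K W' u" "\<And>v w. (v, w) \<in> set ps \<Longrightarrow> cancelling u W v w"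
    "distinct (pair_names ps)"
    "without (set (pair_names ps)) W = W'" "W' \<noteq> []"
  shows "in_K W u"
  using val_cancel_pairs[OF assms(1,3,4,5,6)] assms(2) by blast

lemma val_east:
  assumes W: "gauss_word W" "in_K W u" and d: "distinct [e, n, s]"
    and f: "adjacent W (rgt n) (rgt e)" "adjacent W (lft n) (rgt s)" "adjacent W (lft e) (lft s)"
    and l: "u e = u n \<or> u n \<noteq> u s \<or> u s = u e"
  shows "val W u e = val W u n + val W u s"
proof -
  have "\<exists>D'. r3_move (word_diagram W u) (e, East) (n, North) (s, South) D'"
    by (rule r3_east[OF reads_word_diagram[OF W(1)] d f[THEN adjacent_follows]]) (use l in auto)
  then obtain D' where "r3_move (word_diagram W u) (e, East) (n, North) (s, South) D'" by blast
  from p_r3[OF W(2) this] have "val W u e + (- val W u n) + (- val W u s) = 0"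
    by (simp add: val_def)
  then show ?thesis by (simp add: algebra_simps)
qed

lemma val_west:
  assumes W: "gauss_word W" "in_K W u" and d: "distinct [w, y, z]"
    and f: "adjacent W (rgt w) (rgt y)" "adjacent W (rgt z) (lft y)" "adjacent W (lft z) (lft w)"
    and l: "u w = u y \<or> u y \<noteq> u z \<or> u z = u w"
  shows "val W u w = val W u y + val W u z"
proof -
  have "\<exists>D'. r3_move (word_diagram W u) (w, West) (y, South) (z, North) D'"
    by (rule r3_west[OF reads_word_diagram[OF W(1)] d f[THEN adjacent_follows]]) (use l in auto)
  then obtain D' where "r3_move (word_diagram W u) (w, West) (y, South) (z, North) D'" by blast
  from p_r3[OF W(2) this] have "val W u w + (- val W u y) + (- val W u z) = 0"
    by (simp add: val_def)
  then show ?thesis by (simp add: algebra_simps)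
qed

end

section \<open>The value at a crossing of two strands\<close>

lemma four_fresh:
  fixes S :: "nat set"
  assumes "finite S"
  shows "\<exists>a b c d. distinct [a, b, c, d] \<and> {a, b, c, d} \<inter> S = {}"
proof -
  obtain m where m: "\<forall>t\<in>S. t < m" using assms finite_nat_set_iff_bounded by blast
  have "distinct [m, m + 1, m + 2, m + 3] \<and> {m, m + 1, m + 2, m + 3} \<inter> S = {}" using m by auto
  then show ?thesis by blast
qed

lemma gauss_word_insert:
  assumes "gauss_word W" "distinct Z"
    and Z: "set Z = set W \<union> set (concat (map (\<lambda>v. [lft v, rgt v]) ns))"
  shows "gauss_word Z"
proof -
  obtain V where V: "set W = V \<times> {SW, SE}" using assms(1) unfolding gauss_word_def by blast
  have "set (concat (map (\<lambda>v. [lft v, rgt v]) ns)) = set ns \<times> {SW, SE}" by auto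
  then have "set Z = (V \<union> set ns) \<times> {SW, SE}" using Z V by (simp only: Sigma_Un_distrib1)
  moreover have "Z \<noteq> []" using assms(1) Z by (auto simp: gauss_word_def)
  ultimately show ?thesis using assms(2) unfolding gauss_word_def by blast
qed

text \<open>
  A strand \<open>b\<close> at the beginning of the word and a strand \<open>e\<close> between \<open>A\<close> and \<open>B\<close> run side by
  side, \<open>b\<close> on the left; \<open>b\<close> crosses to the right at \<open>x\<close> and back at \<open>y\<close>.
\<close>

definition parallel_word :: "nat \<Rightarrow> nat \<Rightarrow> (nat \<times> slot) list \<Rightarrow> (nat \<times> slot) list \<Rightarrow> (nat \<times> slot)
  list" where
  "parallel_word x y A B = lft x # rgt y # A @ rgt x # lft y # B"

text \<open>
  The same strands running in opposite directions, \<open>b\<close> on the right of \<open>e\<close>: along \<open>b\<close> the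
  crossing \<open>x\<close> comes first and along \<open>e\<close> the crossing \<open>y\<close> does. At \<open>y\<close> the strand \<open>b\<close> comes from
  SW.
\<close>

definition antiparallel_word :: "nat \<Rightarrow> nat \<Rightarrow> (nat \<times> slot) list \<Rightarrow> (nat \<times> slot) list \<Rightarrow> (nat \<times> slot)
  list" where
  "antiparallel_word x y A B = rgt x # lft y # A @ rgt y # lft x # B"

lemma fst_set_parallel:
  "fst ` set (parallel_word x y A B) = {x, y} \<union> fst ` set (A @ B)"
  "fst ` set (antiparallel_word x y A B) = {x, y} \<union> fst ` set (A @ B)"
  unfolding parallel_word_def antiparallel_word_def by auto

lemma gauss_word_parallel:
  assumes w: "gauss_word (A @ B)" and fr: "{x, y} \<inter> fst ` set (A @ B) = {}" and d: "x \<noteq> y"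
  shows "gauss_word (parallel_word x y A B)" "gauss_word (antiparallel_word x y A B)"
    "without {x, y} (parallel_word x y A B) = A @ B"
      "without {x, y} (antiparallel_word x y A B) = A @ B"
proof -
  have fresh: "v \<notin> fst ` set A" "v \<notin> fst ` set B" if "v \<in> {x, y}" for v using fr that by auto
  have notin: "(v, r) \<notin> set A" "(v, r) \<notin> set B" if "v \<in> {x, y}" for v r
    using fresh[OF that] by force+
  note simps = d d[symmetric] fresh notin without_simps
  have AB: "distinct A" "distinct B" "set A \<inter> set B = {}" using w by (auto simp: gauss_word_def)
  have dz: "distinct (parallel_word x y A B)" "distinct (antiparallel_word x y A B)"
    unfolding parallel_word_def antiparallel_word_def using simps AB by simp_all
  have sz: "set (parallel_word x y A B)
    = set (A @ B) \<union> set (concat (map (\<lambda>v. [lft v, rgt v]) [x, y]))"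
    "set (antiparallel_word x y A B) = set (A @ B) \<union> set (concat (map (\<lambda>v. [lft v, rgt v]) [x, y]))"
    unfolding parallel_word_def antiparallel_word_def by (simp, blast)+
  show "gauss_word (parallel_word x y A B)" "gauss_word (antiparallel_word x y A B)"
    using gauss_word_insert[OF w dz(1) sz(1)] gauss_word_insert[OF w dz(2) sz(2)] .
  show "without {x, y} (parallel_word x y A B) = A @ B"
    "without {x, y} (antiparallel_word x y A B) = A @ B"
    unfolding parallel_word_def antiparallel_word_def using simps by simp_all
qed

context parity_on begin

lemma in_K_parallel:
  assumes w: "gauss_word (A @ B)" and K: "in_K (A @ B) u"
    and fr: "{x, y} \<inter> fst ` set (A @ B) = {}" and d: "x \<noteq> y" and u: "u x \<noteq> u y"
  shows "in_K (parallel_word x y A B) u" "in_K (antiparallel_word x y A B) u"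
proof -
  note g = gauss_word_parallel[OF w fr d]
  have ne: "A @ B \<noteq> []" using w by (simp add: gauss_word_def)
  have a: "adjacent (parallel_word x y A B) (lft x) (rgt y)"
    "adjacent (parallel_word x y A B) (rgt x) (lft y)"
    "adjacent (antiparallel_word x y A B) (rgt x) (lft y)"
      "adjacent (antiparallel_word x y A B) (rgt y) (lft x)"
    unfolding parallel_word_def antiparallel_word_def by (rule adjacent_rules)+
  have c: "cancelling u (parallel_word x y A B) x y" by (rule cancelling_parallel[OF d u a(1,2)])
  have c': "cancelling u (antiparallel_word x y A B) x y"
    by (rule cancelling_antiparallel[OF d u a(3,4)])
  show "in_K (parallel_word x y A B) u"
    using val_cancelling(1)[OF g(1) _ c] ne K by (simp only: g(3)) blast
  show "in_K (antiparallel_word x y A B) u"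
    using val_cancelling(1)[OF g(2) _ c'] ne K by (simp only: g(4)) blast
qed

text \<open>
  The key step. Start from the antiparallel strands \<open>b\<close> and \<open>e\<close> with their crossings \<open>x\<close>, \<open>y\<close>,
  and let a third strand \<open>c\<close>, taken from \<open>e\<close> just before or just after them, cross \<open>e\<close> at \<open>f\<close>,
  \<open>n\<close> and \<open>b\<close> at \<open>s\<close>, \<open>g\<close>. Then \<open>y\<close>, \<open>n\<close>, \<open>s\<close> bound a triangle east of \<open>y\<close>. The values at \<open>y\<close>
  and \<open>s\<close> are the antiparallel and the parallel value of \<open>b\<close> and \<open>e\<close>; the value at \<open>n\<close> is minus
  the one at \<open>f\<close>, which is the value of a self-crossing of \<open>e\<close>. The two possible words \<open>L\<close>
  correspond to the two positions of \<open>c\<close>. The last hypothesis on \<open>u\<close> makes the triangle movable.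
\<close>

lemma compare:
  assumes w: "gauss_word (A @ B)" and K: "in_K (A @ B) u"
    and fr: "{x, y, s, g, f, n} \<inter> fst ` set (A @ B) = {}" and d: "distinct [x, y, s, g, f, n]"
    and u: "u x \<noteq> u y" "u s \<noteq> u g" "u f \<noteq> u n" and l: "u y = u n \<or> u n \<noteq> u s"
    and L: "L = A @ lft f # rgt n # rgt f # lft n # B \<or> L = A @ rgt f # lft n # lft f # rgt n # B"
  shows "val (antiparallel_word x y A B) u y = val (parallel_word s g A B) u s - val L u f"
proof -
  have ds: "x \<noteq> y \<and> x \<noteq> s \<and> x \<noteq> g \<and> x \<noteq> f \<and> x \<noteq> n \<and> y \<noteq> s \<and> y \<noteq> g \<and> y \<noteq> f \<and> y \<noteq> n \<and> s \<noteq> g \<and> s \<noteq> f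
    \<and> s \<noteq> n \<and> g \<noteq> f \<and> g \<noteq> n \<and> f \<noteq> n"
    and ds': "y \<noteq> x \<and> s \<noteq> x \<and> g \<noteq> x \<and> f \<noteq> x \<and> n \<noteq> x \<and> s \<noteq> y \<and> g \<noteq> y \<and> f \<noteq> y \<and> n \<noteq> y \<and> g \<noteq> s
      \<and> f \<noteq> s \<and> n \<noteq> s \<and> f \<noteq> g \<and> n \<noteq> g \<and> n \<noteq> f" using d by auto
  have fresh: "v \<notin> fst ` set A" "v \<notin> fst ` set B" if "v \<in> {x, y, s, g, f, n}" for v
    using fr that by auto
  have notin: "(v, r) \<notin> set A" "(v, r) \<notin> set B" if "v \<in> {x, y, s, g, f, n}" for v r
    using fresh[OF that] by force+
  note simps = ds ds' fresh notin without_simps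
  have AB: "distinct A" "distinct B" "set A \<inter> set B = {}" "A \<noteq> [] \<or> B \<noteq> []" "A @ B \<noteq> []"
    using w by (auto simp: gauss_word_def)
  let ?P = "antiparallel_word x y A B" and ?Q = "parallel_word s g A B"
  have main: "val ?P u y = val ?Q u s - val L u f"
    if gw: "gauss_word Z"
      and a: "adjacent Z (lft s) (rgt g)" "adjacent Z (rgt s) (lft g)"
        "adjacent Z (lft f) (rgt n)" "adjacent Z (rgt f) (lft n)"
        "adjacent Z (rgt x) (lft y)" "adjacent Z (rgt y) (lft x)"
        "adjacent Z (rgt n) (rgt y)" "adjacent Z (lft n) (rgt s)" "adjacent Z (lft y) (lft s)"
      and e: "without {x, y, s, g, f, n} Z = A @ B" "without {s, g, f, n} Z = ?P"
        "without {x, y, f, n} Z = ?Q" "without {x, y, s, g} Z = L" and f: "f \<in> fst ` set L" for Z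
  proof -
    have c: "cancelling u Z x y" "cancelling u Z s g" "cancelling u Z f n"
      using cancelling_antiparallel[OF _ u(1) a(5,6)] cancelling_parallel[OF _ u(2) a(1,2)]
        cancelling_parallel[OF _ u(3) a(3,4)] ds by simp_all
    have K: "in_K Z u"
      by (rule in_K_insert[OF gw K, of "[(x, y), (s, g), (f, n)]"]) (use c ds e AB in auto)
    have "without {f, n} Z \<noteq> []"
      by (rule without_nonempty[of "{s, g, f, n}"]) (auto simp: e antiparallel_word_def)
    then have n: "val Z u n = - val Z u f" using val_cancelling(3)[OF gw _ c(3)] K by blast
    have y: "val Z u y = val ?P u y"
      by (rule val_remove[OF gw K, of "[(s, g), (f, n)]"])
        (use c ds e in \<open>auto simp: antiparallel_word_def\<close>)
    have s: "val Z u s = val ?Q u s"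
      by (rule val_remove[OF gw K, of "[(x, y), (f, n)]"])
        (use c ds e in \<open>auto simp: parallel_word_def\<close>)
    have f: "val Z u f = val L u f"
      by (rule val_remove[OF gw K, of "[(x, y), (s, g)]"]) (use c ds e f in auto)
    have "val Z u y = val Z u n + val Z u s"
      by (rule val_east[OF gw K _ a(7,8,9)]) (use ds ds' l in auto)
    then show ?thesis using n y s f by simp
  qed
  from L show ?thesis
  proof
    assume L: "L = A @ lft f # rgt n # rgt f # lft n # B"
    \<comment> \<open>\<open>c\<close> is taken behind the crossings of \<open>b\<close> and \<open>e\<close>\<close>
    let ?Z = "rgt x # lft y # lft s # rgt g # A @ lft f # rgt n # rgt y # lft x # rgt f # lft n #
      rgt s # lft g # B"
    have dz: "distinct ?Z" using simps AB by simp
    have sz: "set ?Z = set (A @ B) \<union> set (concat (map (\<lambda>v. [lft v, rgt v]) [x, y, s, g, f, n]))"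
      by (simp, blast)
    have gw: "gauss_word ?Z" by (rule gauss_word_insert[OF w dz sz])
    have a: "adjacent ?Z (lft s) (rgt g)" "adjacent ?Z (rgt s) (lft g)"
      "adjacent ?Z (lft f) (rgt n)"
        "adjacent ?Z (rgt f) (lft n)" "adjacent ?Z (rgt x) (lft y)" "adjacent ?Z (rgt y) (lft x)"
        "adjacent ?Z (rgt n) (rgt y)" "adjacent ?Z (lft n) (rgt s)" "adjacent ?Z (lft y) (lft s)"
      by (rule adjacent_rules)+
    have e: "without {x, y, s, g, f, n} ?Z = A @ B" "without {s, g, f, n} ?Z = ?P"
        "without {x, y, f, n} ?Z = ?Q" "without {x, y, s, g} ?Z = L" "f \<in> fst ` set L"
      unfolding L parallel_word_def antiparallel_word_def using simps by simp_all
    show ?thesis by (rule main[OF gw a e])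
  next
    assume L: "L = A @ rgt f # lft n # lft f # rgt n # B"
    \<comment> \<open>\<open>c\<close> is taken before them\<close>
    let ?Z = "rgt x # lft y # lft s # rgt g # A @ rgt f # lft n # rgt s # lft g # lft f # rgt n #
      rgt y # lft x # B"
    have dz: "distinct ?Z" using simps AB by simp
    have sz: "set ?Z = set (A @ B) \<union> set (concat (map (\<lambda>v. [lft v, rgt v]) [x, y, s, g, f, n]))"
      by (simp, blast)
    have gw: "gauss_word ?Z" by (rule gauss_word_insert[OF w dz sz])
    have a: "adjacent ?Z (lft s) (rgt g)" "adjacent ?Z (rgt s) (lft g)"
      "adjacent ?Z (lft f) (rgt n)"
        "adjacent ?Z (rgt f) (lft n)" "adjacent ?Z (rgt x) (lft y)" "adjacent ?Z (rgt y) (lft x)"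
        "adjacent ?Z (rgt n) (rgt y)" "adjacent ?Z (lft n) (rgt s)" "adjacent ?Z (lft y) (lft s)"
      by (rule adjacent_rules)+
    have e: "without {x, y, s, g, f, n} ?Z = A @ B" "without {s, g, f, n} ?Z = ?P"
        "without {x, y, f, n} ?Z = ?Q" "without {x, y, s, g} ?Z = L" "f \<in> fst ` set L"
      unfolding L parallel_word_def antiparallel_word_def using simps by simp_all
    show ?thesis by (rule main[OF gw a e])
  qed
qed

text \<open>
  The self-crossing of \<open>e\<close> as a parallel crossing of two strands at the beginning of the rotated
  word, one of them directly behind the other. Which of them is the left one is the choice in
  \<open>L\<close>.
\<close>

lemma compare_loop:
  assumes w: "gauss_word (A @ B)" and K: "in_K (A @ B) u"
    and fr: "{x, y, s, g, f, n} \<inter> fst ` set (A @ B) = {}" and d: "distinct [x, y, s, g, f, n]"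
    and u: "u x \<noteq> u y" "u s \<noteq> u g" "u f \<noteq> u n" and l: "u y = u n \<or> u n \<noteq> u s"
    and L: "L = parallel_word f n [] (B @ A) \<or> L = parallel_word f n (B @ A) []"
  shows "val (antiparallel_word x y A B) u y = val (parallel_word s g A B) u s - val L u f"
proof -
  note cmp = compare[OF w K fr d u l]
  have w': "gauss_word (B @ A)" by (rule gauss_word_rotate[OF w])
  have K': "in_K (B @ A) u" by (rule val_rotate(1)[OF w K])
  have fr': "{f, n} \<inter> fst ` set (B @ A) = {}" "f \<noteq> n" using fr d by auto
  from L show ?thesis
  proof
    assume L: "L = parallel_word f n [] (B @ A)"
    then have L': "L = ([lft f, rgt n, rgt f, lft n] @ B) @ A" by (simp add: parallel_word_def)
    have "gauss_word L" "in_K L u"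
      unfolding L using gauss_word_parallel(1)[of "[]" "B @ A"] in_K_parallel(1)[of "[]"
        "B @ A"] w' K' fr' u by simp_all
    from val_rotate(2)[OF this[unfolded L'], of f] have "val (A @ lft f # rgt n # rgt f # lft n #
      B) u f = val L u f"
      unfolding L' by simp
    with cmp[OF disjI1[OF refl]] show ?thesis by simp
  next
    assume L: "L = parallel_word f n (B @ A) []"
    then have L': "L = ([lft f, rgt n] @ B) @ (A @ [rgt f, lft n])" by (simp add: parallel_word_def)
    have "gauss_word L" "in_K L u"
      unfolding L using gauss_word_parallel(1)[of "B @ A" "[]"] in_K_parallel(1)[of "B @ A"
        "[]"] w' K' fr' u by simp_all
    from val_rotate(2)[OF this[unfolded L'], of f] have "val (A @ rgt f # lft n # lft f # rgt n #
      B) u f = val L u f"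
      unfolding L' by simp
    with cmp[OF disjI2[OF refl]] show ?thesis by simp
  qed
qed

text \<open>
  The right-hand side mentions neither \<open>s\<close>, \<open>g\<close> nor the strand that is on top in the parallel
  crossing. Giving the crossings \<open>b\<close> and \<open>n\<close> the same level makes the triangle of \<open>compare\<close>
  movable whatever \<open>u'\<close> is.
\<close>

lemma val_parallel_indep:
  assumes w: "gauss_word (A @ B)" and K: "in_K (A @ B) u"
    and d: "distinct [a, b, f, n]" and fr: "{a, b, f, n} \<inter> fst ` set (A @ B) = {}"
    and x: "{s, g} \<inter> fst ` set (A @ B) = {}" "{s, g} \<inter> {a, b, f, n} = {}" "s \<noteq> g" "u' s \<noteq> u' g"
    and agree: "\<And>v. v \<in> fst ` set (A @ B) \<Longrightarrow> u' v = u v"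
  shows "val (parallel_word s g A B) u' s
    = val (antiparallel_word a b A B) (u(a := True, b := False)) b
      + val (parallel_word f n [] (B @ A)) (u(f := True, n := False)) f"
proof -
  define v where "v = u'(a := True, b := False, f := True, n := False)"
  have w': "gauss_word ([] @ (B @ A))" using gauss_word_rotate[OF w] by simp
  have Ku: "in_K (A @ B) u1" if "\<And>t. t \<in> fst ` set (A @ B) \<Longrightarrow> u1 t = u t" for u1
    by (rule val_cong(1)[OF w K that])
  have Kv: "in_K (A @ B) v" by (rule Ku) (use agree fr in \<open>auto simp: v_def\<close>)
  have Ku': "in_K (A @ B) u'" by (rule Ku) (rule agree)
  have "val (antiparallel_word a b A B) v b
    = val (parallel_word s g A B) v s - val (parallel_word f n [] (B @ A)) v f"
  proof (rule compare_loop[OF w Kv])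
    have v: "v a" "\<not> v b" "v f" "\<not> v n" "v s = u' s" "v g = u' g"
      using d x(2) by (auto simp: v_def)
    show "{a, b, s, g, f, n} \<inter> fst ` set (A @ B) = {}" using fr x(1) by blast
    show "distinct [a, b, s, g, f, n]" using d x(2,3) by auto
    show "v a \<noteq> v b" "v s \<noteq> v g" "v f \<noteq> v n" "v b = v n \<or> v n \<noteq> v s" using v x(4) by auto
  qed simp
  moreover have "val (parallel_word s g A B) v s = val (parallel_word s g A B) u' s"
    by (rule val_cong(2)[OF gauss_word_parallel(1)[OF w x(1,3)] in_K_parallel(1)[OF w Ku'
      x(1,3,4)]])
      (use x fr in \<open>auto simp: v_def fst_set_parallel\<close>)
  moreover have "val (antiparallel_word a b A B) v b
    = val (antiparallel_word a b A B) (u(a := True, b := False)) b"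
  proof (rule val_cong(2)[OF gauss_word_parallel(2)[OF w] in_K_parallel(2)[OF w Ku]])
    fix t assume "t \<in> fst ` set (antiparallel_word a b A B)"
    then have "t \<in> {a, b} \<or> t \<in> fst ` set (A @ B)" unfolding fst_set_parallel by blast
    then show "v t = (u(a := True, b := False)) t" using d fr agree by (auto simp: v_def)
  qed (use d fr in \<open>auto simp: fst_set_parallel\<close>)
  moreover have "val (parallel_word f n [] (B @ A)) v f
    = val (parallel_word f n [] (B @ A)) (u(f := True, n := False)) f"
  proof (rule val_cong(2)[OF gauss_word_parallel(1)[OF w'] in_K_parallel(1)[OF w']])
    have "in_K (A @ B) (u(f := True, n := False))" by (rule Ku) (use fr in auto)
    from val_rotate(1)[OF w this] show "in_K ([] @ B @ A) (u(f := True, n := False))" by simp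
    fix t assume "t \<in> fst ` set (parallel_word f n [] (B @ A))"
    then have "t \<in> {f, n} \<or> t \<in> fst ` set (A @ B)" unfolding fst_set_parallel by auto
    then show "v t = (u(f := True, n := False)) t" using d fr agree by (auto simp: v_def)
  qed (use d fr in \<open>auto simp: fst_set_parallel\<close>)
  ultimately show ?thesis by simp
qed

text \<open>
  \<open>F\<^sub>b(e)\<close> for the strands \<open>b\<close> at the beginning of \<open>A @ B\<close> and \<open>e\<close> between \<open>A\<close> and \<open>B\<close>, computed
  with two particular new crossings and with \<open>b\<close> on top; \<open>val_parallel_word\<close> shows that every
  other choice gives the same value. In particular, \<open>crossing_value u [] W\<close> belongs to two
  pieces of the arc that ends at the first letter of \<open>W\<close>.
\<close>

definition crossing_value :: "(nat \<Rightarrow> bool) \<Rightarrow> (nat \<times> slot) list \<Rightarrow> (nat \<times> slot) list \<Rightarrow> 'a" where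
  "crossing_value u A B = (let m = Suc (Max (fst ` set (A @ B)))
     in val (parallel_word m (Suc m) A B) (u(m := True, Suc m := False)) m)"

text \<open>
  Both values equal the same right-hand side of \<open>val_parallel_indep\<close>.
\<close>

lemma val_parallel_word:
  assumes w: "gauss_word (A @ B)" and K: "in_K (A @ B) u"
    and x: "{x, y} \<inter> fst ` set (A @ B) = {}" "x \<noteq> y" "u' x \<noteq> u' y"
    and agree: "\<And>v. v \<in> fst ` set (A @ B) \<Longrightarrow> u' v = u v"
  shows "val (parallel_word x y A B) u' x = crossing_value u A B"
proof -
  define m where "m = Suc (Max (fst ` set (A @ B)))"
  have m: "t < m" if "t \<in> fst ` set (A @ B)" for t
    unfolding m_def using that by (intro le_imp_less_Suc Max_ge) simp_all
  have mf: "{m, Suc m} \<inter> fst ` set (A @ B) = {}"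
  proof -
    have "m \<notin> fst ` set (A @ B)" "Suc m \<notin> fst ` set (A @ B)" using m[of m] m[of "Suc m"] by auto
    then show ?thesis by blast
  qed
  obtain a b f n where abfn: "distinct [a, b, f, n]"
    "{a, b, f, n} \<inter> (fst ` set (A @ B) \<union> {x, y, m, Suc m}) = {}"
    using four_fresh[of "fst ` set (A @ B) \<union> {x, y, m, Suc m}"] by auto
  have fr: "{a, b, f, n} \<inter> fst ` set (A @ B) = {}" "{x, y} \<inter> {a, b, f, n} = {}"
    "{m, Suc m} \<inter> {a, b, f, n} = {}"
    using abfn(2) by blast+
  have "crossing_value u A B = val (parallel_word m (Suc m) A B) (u(m := True, Suc m := False)) m"
    unfolding crossing_value_def m_def Let_def ..
  also have "\<dots> = val (antiparallel_word a b A B) (u(a := True, b := False)) b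
      + val (parallel_word f n [] (B @ A)) (u(f := True, n := False)) f"
  proof (rule val_parallel_indep[OF w K abfn(1) fr(1) mf fr(3)])
    show "(u(m := True, Suc m := False)) t = u t" if "t \<in> fst ` set (A @ B)" for t
      using m[OF that] by simp
  qed simp_all
  also have "\<dots> = val (parallel_word x y A B) u' x"
    by (rule val_parallel_indep[OF w K abfn(1) fr(1) x(1) fr(2) x(2,3) agree, symmetric])
  finally show ?thesis ..
qed

text \<open>
  The values for parallel and antiparallel strands differ by the coefficient \<open>\<delta>\<^sub>e\<close>. The second
  claim says that for two pieces of the same arc it is irrelevant which one is the left strand;
  it holds because \<open>compare_loop\<close> is true for both positions of the third strand.
\<close>

lemma val_antiparallel_word:
  assumes w: "gauss_word (A @ B)" and K: "in_K (A @ B) u"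
    and x: "{x, y} \<inter> fst ` set (A @ B) = {}" "x \<noteq> y" "u' x \<noteq> u' y"
    and agree: "\<And>v. v \<in> fst ` set (A @ B) \<Longrightarrow> u' v = u v"
  shows "val (antiparallel_word x y A B) u' y = crossing_value u A B - crossing_value u [] (B @ A)"
    and "crossing_value u [] (B @ A) = crossing_value u (B @ A) []"
proof -
  obtain s g f n where sgfn: "distinct [s, g, f, n]"
    "{s, g, f, n} \<inter> (fst ` set (A @ B) \<union> {x, y}) = {}"
    using four_fresh[of "fst ` set (A @ B) \<union> {x, y}"] by auto
  have fr: "{s, g} \<inter> fst ` set (A @ B) = {}" "{f, n} \<inter> fst ` set (A @ B) = {}" "s \<noteq> g" "f \<noteq> n"
    using sgfn by auto
  define v where "v = u'(s := True, g := False, f := \<not> u' y, n := u' y)"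
  have vs: "v s \<noteq> v g" "v f \<noteq> v n" using sgfn by (auto simp: v_def)
  have va: "v t = u t" if "t \<in> fst ` set (A @ B)" for t using that agree sgfn(2)
    by (auto simp: v_def)
  have Kv: "in_K (A @ B) v" by (rule val_cong(1)[OF w K va])
  have Ku': "in_K (A @ B) u'" by (rule val_cong(1)[OF w K agree])
  have w': "gauss_word (B @ A)" by (rule gauss_word_rotate[OF w])
  have K': "in_K (B @ A) u" by (rule val_rotate(1)[OF w K])
  have fr': "{f, n} \<inter> fst ` set (B @ A) = {}" using fr(2) by (simp add: Un_commute)
  have va': "v t = u t" if "t \<in> fst ` set (B @ A)" for t using that va by auto
  have 1: "val (antiparallel_word x y A B) v y = val (antiparallel_word x y A B) u' y"
    by (rule val_cong(2)[OF gauss_word_parallel(2)[OF w x(1,2)] in_K_parallel(2)[OF w Ku' x]])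
      (use sgfn in \<open>auto simp: v_def fst_set_parallel\<close>)
  have 2: "val (parallel_word s g A B) v s = crossing_value u A B"
    by (rule val_parallel_word[OF w K fr(1,3) vs(1) va])
  have 3: "val (parallel_word f n [] (B @ A)) v f = crossing_value u [] (B @ A)"
    by (rule val_parallel_word) (simp_all add: w' K' fr' fr vs va' del: set_append)
  have 4: "val (parallel_word f n (B @ A) []) v f = crossing_value u (B @ A) []"
    by (rule val_parallel_word) (simp_all add: w' K' fr' fr vs va' del: set_append)
  have cl: "val (antiparallel_word x y A B) v y = val (parallel_word s g A B) v s - val L v f"
    if "L = parallel_word f n [] (B @ A) \<or> L = parallel_word f n (B @ A) []" for L
  proof (rule compare_loop[OF w Kv _ _ _ vs _ that])
    show "{x, y, s, g, f, n} \<inter> fst ` set (A @ B) = {}" using x(1) sgfn(2) by blast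
    show "distinct [x, y, s, g, f, n]" using x(2) sgfn by auto
    show "v x \<noteq> v y" using x(3) sgfn by (auto simp: v_def)
    show "v y = v n \<or> v n \<noteq> v s" using sgfn by (auto simp: v_def)
  qed
  show "val (antiparallel_word x y A B) u' y = crossing_value u A B - crossing_value u [] (B @ A)"
    using cl[of "parallel_word f n [] (B @ A)"] 1 2 3 by simp
  show "crossing_value u [] (B @ A) = crossing_value u (B @ A) []"
    using cl[of "parallel_word f n [] (B @ A)"] cl[of "parallel_word f n (B @ A) []"] 3 4 by simp
qed

lemma crossing_value_loop:
  assumes "gauss_word W" "in_K W u"
  shows "crossing_value u [] W = crossing_value u W []"
proof -
  obtain x y z t where xy: "distinct [x, y, z, t]" "{x, y, z, t} \<inter> fst ` set W = {}"
    using four_fresh[of "fst ` set W"] by auto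
  have "crossing_value u [] (W @ []) = crossing_value u (W @ []) []"
    by (rule val_antiparallel_word(2)[where x = x and y = y and u' = "u(x := True, y := False)"])
      (use assms xy in auto)
  then show ?thesis by simp
qed

end

section \<open>Pushing a strand across a crossing\<close>

lemma distinct_concat_map:
  assumes "distinct D" "\<And>t. t \<in> set D \<Longrightarrow> distinct (f t)"
    "\<And>s t. s \<in> set D \<Longrightarrow> t \<in> set D \<Longrightarrow> s \<noteq> t \<Longrightarrow> set (f s) \<inter> set (f t) = {}"
  shows "distinct (concat (map f D))"
  using assms by (induction D) fastforce+

text \<open>
  The passages of \<open>w\<close> are replaced by longer words: a strand is laid across the strands of \<open>w\<close>
  near this crossing. Treating both passages at once avoids distinguishing which of them comes
  first in the word.
\<close>

definition substitute ::
  "nat \<Rightarrow> (nat \<times> slot) list \<Rightarrow> (nat \<times> slot) list \<Rightarrow> (nat \<times> slot) list \<Rightarrow> (nat \<times> slot) list" where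
  "substitute w X Y D = concat (map (\<lambda>t. if t = lft w then X else if t = rgt w then Y else [t]) D)"

lemma substitute_append:
  "substitute w X Y (A @ lft w # B) = substitute w X Y A @ X @ substitute w X Y B"
  "substitute w X Y (A @ rgt w # B) = substitute w X Y A @ Y @ substitute w X Y B"
  by (simp_all add: substitute_def)

lemma substitute_same: "substitute w [lft w] [rgt w] D = D"
  unfolding substitute_def by (induction D) auto

lemma substitute_lft:
  assumes "distinct (P @ lft w # S)"
  shows "substitute w X [rgt w] (P @ lft w # S) = P @ X @ S"
proof -
  have "substitute w X [rgt w] Q = Q" if "lft w \<notin> set Q" for Q
    using that unfolding substitute_def by (induction Q) auto
  from this[of P] this[of S] show ?thesis
    using assms by (simp add: substitute_append)
qed

lemma substitute_rgt:
  assumes "distinct (P @ rgt w # S)"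
  shows "substitute w [lft w] Y (P @ rgt w # S) = P @ Y @ S"
proof -
  have "substitute w [lft w] Y Q = Q" if "rgt w \<notin> set Q" for Q
    using that unfolding substitute_def by (induction Q) auto
  from this[of P] this[of S] show ?thesis
    using assms by (simp add: substitute_append)
qed

lemma without_substitute:
  "S \<inter> fst ` set D = {} \<Longrightarrow> without S (substitute w X Y D)
    = substitute w (without S X) (without S Y) D"
  unfolding substitute_def by (induction D) (auto simp: without_simps(1-3))

text \<open>
  \<open>H\<close> lists the new crossings as they are met along the new strand; the letters of \<open>H @ X @ Y\<close>
  are those of \<open>w\<close> and of the new crossings.
\<close>

lemma gauss_word_substitute:
  assumes D: "gauss_word D" and w: "w \<in> fst ` set D" and N: "N \<inter> fst ` set D = {}"
    and d: "distinct (H @ X @ Y)" and s: "set (H @ X @ Y) = insert w N \<times> {SW, SE}"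
  shows "gauss_word (H @ substitute w X Y D)"
proof -
  have dD: "distinct D" using D by (simp add: gauss_word_def)
  have in_D: "lft w \<in> set D" "rgt w \<in> set D" using w gauss_word_set[OF D] by blast+
  let ?f = "\<lambda>t. if t = lft w then X else if t = rgt w then Y else [t]"
  have new: "t \<in> set D \<Longrightarrow> t = lft w \<or> t = rgt w" if "t \<in> set (H @ X @ Y)" for t
  proof -
    assume t: "t \<in> set D"
    have "fst t \<in> insert w N" "snd t \<in> {SW, SE}" using that unfolding s by auto
    moreover have "fst t \<notin> N" using t N by auto
    ultimately show ?thesis by (cases t) auto
  qed
  have "distinct (concat (map ?f D))"
  proof (rule distinct_concat_map[OF dD])
    show "distinct (?f t)" for t using d by simp
    fix s t assume st: "s \<in> set D" "t \<in> set D" "s \<noteq> t"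
    show "set (?f s) \<inter> set (?f t) = {}"
      using new[of s] new[of t] st d by auto
  qed
  moreover have set_sub: "set (substitute w X Y D) = (set D - {lft w, rgt w}) \<union> set X \<union> set Y"
    using in_D by (auto simp: substitute_def split: if_splits)
  moreover have "set H \<inter> set (substitute w X Y D) = {}"
    using new d unfolding set_sub by auto
  ultimately have dist: "distinct (H @ substitute w X Y D)"
    using d by (simp add: substitute_def)
  have "set (H @ substitute w X Y D) = (set D - {lft w, rgt w}) \<union> set (H @ X @ Y)"
    unfolding set_append set_sub by blast
  also have "\<dots> = (fst ` set D \<union> N) \<times> {SW, SE}"
  proof -
    obtain V where V: "set D = V \<times> {SW, SE}" using D unfolding gauss_word_def by blast
    have "fst ` (V \<times> {SW, SE}) = V" by force
    moreover have "w \<in> V" using in_D V by blast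
    moreover have "V \<times> {SW, SE} - {lft w, rgt w} \<union> insert w N \<times> {SW, SE} = (V \<union> N) \<times> {SW, SE}"
      using \<open>w \<in> V\<close> by blast
    ultimately show ?thesis unfolding s V by simp
  qed
  finally have "set (H @ substitute w X Y D) = (fst ` set D \<union> N) \<times> {SW, SE}" .
  moreover have "H @ substitute w X Y D \<noteq> []"
    using calculation w by (metis SigmaI UnI1 insertI1 list.set(1) empty_iff)
  ultimately show ?thesis unfolding gauss_word_def using dist by blast
qed

lemma adjacent_substitute:
  assumes D: "gauss_word D" and w: "w \<in> fst ` set D" 
    and a: "adjacent X x y \<or> adjacent Y x y \<or> adjacent H x y"
  shows "adjacent (H @ substitute w X Y D) x y"
proof -
  have in_D: "lft w \<in> set D" "rgt w \<in> set D" using w gauss_word_set[OF D] by blast+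
  obtain P S P' S' where "D = P @ lft w # S" "D = P' @ rgt w # S'"
    using split_list[OF in_D(1)] split_list[OF in_D(2)] by blast
  then obtain A B A' B' where "substitute w X Y D = A @ X @ B" "substitute w X Y D = A' @ Y @ B'"
    using substitute_append by metis
  then show ?thesis using a
    by (metis adjacent_left adjacent_append)
qed

context parity_on begin

text \<open>
  Two bigons \<open>a\<close>, \<open>b\<close> and \<open>c\<close>, \<open>d\<close> are added to \<open>D\<close>. Values at crossings of one bigon may be
  computed after cancelling the other one.
\<close>

lemma val_two_bigons:
  assumes K: "in_K D v" and g: "gauss_word Z"
    and can: "cancelling v Z a b" "cancelling v Z c d" and d: "distinct [a, b, c, d]"
    and e: "without {a, b, c, d} Z = D" "without {c, d} Z = X" "without {a, b} Z = Y"
    and ne: "D \<noteq> []"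
  shows "in_K Z v" "t \<in> fst ` set D \<Longrightarrow> val Z v t = val D v t"
    "t \<in> {a, b} \<Longrightarrow> val Z v t = val X v t" "t \<in> {c, d} \<Longrightarrow> val Z v t = val Y v t"
    "val Z v b = - val Z v a" "val Z v d = - val Z v c"
proof -
  show KZ: "in_K Z v"
    by (rule in_K_insert[OF g K, of "[(a, b), (c, d)]"]) (use can d e ne in auto)
  show "val Z v t = val D v t" if "t \<in> fst ` set D"
    by (rule val_remove[OF g KZ, of "[(a, b), (c, d)]"]) (use can d e that in auto)
  note in_Z = cancelling_in[OF can(1)] cancelling_in[OF can(2)]
  show "val Z v t = val X v t" if "t \<in> {a, b}"
  proof (rule val_remove[OF g KZ, of "[(c, d)]"])
    show "t \<in> fst ` set X" unfolding e(2)[symmetric] fst_set_without using in_Z that d by auto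
  qed (use can d e in auto)
  show "val Z v t = val Y v t" if "t \<in> {c, d}"
  proof (rule val_remove[OF g KZ, of "[(a, b)]"])
    show "t \<in> fst ` set Y" unfolding e(3)[symmetric] fst_set_without using in_Z that d by auto
  qed (use can d e in auto)
  have "without {a, b, c, d} Z \<noteq> []" unfolding e(1) by (rule ne)
  note ne' = without_nonempty[OF this]
  show "val Z v b = - val Z v a" by (rule val_cancelling(3)[OF g ne' can(1) disjI1[OF KZ]]) blast
  show "val Z v d = - val Z v c" by (rule val_cancelling(3)[OF g ne' can(2) disjI1[OF KZ]]) blast
qed

text \<open>
  Here \<open>P\<close> and \<open>S\<close> (\<open>P'\<close> and \<open>S'\<close>) are the parts of the word before and after the passage of \<open>w\<close>
  from SW (from SE), so the four crossing values are \<open>F\<^sub>b\<close> at the ends of the four arcs \<open>s\<close>,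
  \<open>n\<close>, \<open>t\<close>, \<open>m\<close> at \<open>w\<close>, where \<open>b\<close> is a strand at the beginning of the word. In each of the three
  cases \<open>b\<close> makes a second move with each of two of these arcs, and the crossings nearest to \<open>w\<close>
  bound a triangle with \<open>w\<close>: the strand \<open>b\<close> passes west of \<open>w\<close> across \<open>s\<close> and \<open>m\<close>, north of \<open>w\<close>
  across \<open>m\<close> and \<open>n\<close>, or south of \<open>w\<close> across \<open>t\<close> and \<open>s\<close>. In the last two cases one of the
  bigons has to be antiparallel for its crossing on the right side to be the one nearest to \<open>w\<close>;
  this is where the terms \<open>crossing_value u []\<close> come from.
\<close>

lemma crossing_relations:
  assumes w: "gauss_word D" and K: "in_K D u" 
    and DL: "D = P @ lft w # S" and DR: "D = P' @ rgt w # S'"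
  shows "val D u w = crossing_value u (P' @ [rgt w]) S' - crossing_value u P (lft w # S)"
    and "crossing_value u (P' @ [rgt w]) S' - crossing_value u [] (S' @ P' @ [rgt w])
      = val D u w + crossing_value u (P @ [lft w]) S"
    and "crossing_value u P (lft w # S) - crossing_value u [] (lft w # S @ P)
      = crossing_value u P' (rgt w # S') - val D u w"
proof -
  obtain a b c d where d: "distinct [a, b, c, d]" and fr: "{a, b, c, d} \<inter> fst ` set D = {}"
    using four_fresh[of "fst ` set D"] by auto
  have wD: "w \<in> fst ` set D" unfolding DL by simp
  have ds: "a \<noteq> b \<and> a \<noteq> c \<and> a \<noteq> d \<and> b \<noteq> c \<and> b \<noteq> d \<and> c \<noteq> d"
    and ds': "b \<noteq> a \<and> c \<noteq> a \<and> d \<noteq> a \<and> c \<noteq> b \<and> d \<noteq> b \<and> d \<noteq> c" using d by auto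
  have parts: "fst ` set P \<subseteq> fst ` set D" "fst ` set S \<subseteq> fst ` set D"
    unfolding DL by auto
  have parts': "fst ` set P' \<subseteq> fst ` set D" "fst ` set S' \<subseteq> fst ` set D"
    unfolding DR by auto
  have fresh: "t \<notin> fst ` set D" "t \<noteq> w" "w \<noteq> t" "t \<notin> fst ` set P" "t \<notin> fst ` set S"
    "t \<notin> fst ` set P'" "t \<notin> fst ` set S'"
    if "t \<in> {a, b, c, d}" for t
  proof -
    show t: "t \<notin> fst ` set D" using that fr by blast
    show "t \<notin> fst ` set P" "t \<notin> fst ` set S" "t \<notin> fst ` set P'" "t \<notin> fst ` set S'"
      using contra_subsetD[OF _ t] parts parts' by simp_all
    show "t \<noteq> w" "w \<noteq> t" using t wD by metis+
  qed
  have D: "distinct D" "D \<noteq> []" using w by (simp_all add: gauss_word_def)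
  have sub: "substitute w X [rgt w] D = P @ X @ S" "substitute w [lft w] X D = P' @ X @ S'" for X
    by (rule substitute_lft[OF D(1)[unfolded DL], folded DL],
        rule substitute_rgt[OF D(1)[unfolded DR], folded DR])
  note simps = ds ds' fresh without_simps(1-3) without_substitute sub substitute_same
  \<comment> \<open>With these levels each triangle below is movable, whatever the level of \<open>w\<close> is.\<close>
  define v where "v = u(a := True, b := False, c := True, d := False)"
  have v: "v a" "\<not> v b" "v c" "\<not> v d" using ds by (auto simp: v_def)
  then have vn: "v a \<noteq> v b" "v b \<noteq> v a" "v c \<noteq> v d" "v d \<noteq> v c" by simp_all
  have agree: "v t = u t" if "t \<in> fst ` set D" for t using that fr by (auto simp: v_def)
  have K': "in_K D v" by (rule val_cong(1)[OF w K agree])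
  have Dw: "val D v w = val D u w" by (rule val_cong(2)[OF w K agree wD])
  have par: "val (parallel_word x y A B) v x = crossing_value u A B"
    if "A @ B = D" "{x, y} \<subseteq> {a, b, c, d}" "x \<noteq> y" "v x \<noteq> v y" for x y A B
    by (rule val_parallel_word) (use that w K fr agree in auto)
  have anti: "val (antiparallel_word x y A B) v y
    = crossing_value u A B - crossing_value u [] (B @ A)"
    if "A @ B = D" "{x, y} \<subseteq> {a, b, c, d}" "x \<noteq> y" "v x \<noteq> v y" for x y A B
    by (rule val_antiparallel_word(1)) (use that w K fr agree in auto)
  have split: "P @ (lft w # S) = D" "(P @ [lft w]) @ S = D" "P' @ (rgt w # S') = D"
    "(P' @ [rgt w]) @ S' = D"
    using DL DR by simp_all
  show "val D u w = crossing_value u (P' @ [rgt w]) S' - crossing_value u P (lft w # S)"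
  proof -
    let ?H = "[lft a, rgt b, lft c, rgt d]" and ?X = "[rgt a, lft b, lft w]"
      and ?Y = "[rgt w, rgt c, lft d]"
    let ?Z = "?H @ substitute w ?X ?Y D"
    let ?Z1 = "parallel_word a b P (lft w # S)"
    let ?Z2 = "parallel_word c d (P' @ [rgt w]) S'"
    have gw: "gauss_word ?Z"
      by (rule gauss_word_substitute[OF w wD fr]) (simp add: simps, simp, blast)
    have ad: "adjacent ?Z (lft a) (rgt b)" "adjacent ?Z (rgt a) (lft b)"
        "adjacent ?Z (lft c) (rgt d)" "adjacent ?Z (rgt c) (lft d)"
        "adjacent ?Z (rgt w) (rgt c)" "adjacent ?Z (rgt b) (lft c)" "adjacent ?Z (lft b) (lft w)"
      by (rule adjacent_substitute[OF w wD], simp add: adjacent_Cons_iff)+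
    have c: "cancelling v ?Z a b" "cancelling v ?Z c d"
      using cancelling_parallel[OF _ vn(1) ad(1,2)] cancelling_parallel[OF _ vn(3) ad(3,4)] ds ds'
      by simp_all
    have e: "without {a, b, c, d} ?Z = D" "without {c, d} ?Z = ?Z1" "without {a, b} ?Z = ?Z2"
      unfolding parallel_word_def antiparallel_word_def by (simp_all add: simps)
    have n: "distinct [a, b, c, d]" using ds ds' by simp
    note z = val_two_bigons[OF K' gw c n e D(2)]
    have "val ?Z v w = val ?Z v c + val ?Z v b"
      by (rule val_west[OF gw z(1) _ ad(5-7)]) (use ds ds' fresh v in auto)
    also have "val ?Z v b = - val ?Z1 v a" using z(3)[of a] z(5) by simp
    also have "val ?Z1 v a = crossing_value u P (lft w # S)"
      by (rule par[OF split(1)]) (use ds v in auto)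
    also have "val ?Z v c = val ?Z2 v c" by (rule z(4)) simp
    also have "val ?Z2 v c = crossing_value u (P' @ [rgt w]) S'"
      by (rule par[OF split(4)]) (use ds v in auto)
    finally show ?thesis using z(2)[OF wD] Dw by simp
  qed
  show "crossing_value u (P' @ [rgt w]) S' - crossing_value u [] (S' @ P' @ [rgt w])
      = val D u w + crossing_value u (P @ [lft w]) S"
  proof -
    let ?H = "[rgt b, lft a, lft c, rgt d]" and ?X = "[lft w, rgt c, lft d]"
      and ?Y = "[rgt w, rgt a, lft b]"
    let ?Z = "?H @ substitute w ?X ?Y D"
    let ?Z1 = "antiparallel_word b a (P' @ [rgt w]) S'"
    let ?Z2 = "parallel_word c d (P @ [lft w]) S"
    have gw: "gauss_word ?Z"
      by (rule gauss_word_substitute[OF w wD fr]) (simp add: simps, simp, blast)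
    have ad: "adjacent ?Z (rgt b) (lft a)" "adjacent ?Z (rgt a) (lft b)"
        "adjacent ?Z (lft c) (rgt d)" "adjacent ?Z (rgt c) (lft d)"
        "adjacent ?Z (rgt w) (rgt a)" "adjacent ?Z (lft w) (rgt c)" "adjacent ?Z (lft a) (lft c)"
      by (rule adjacent_substitute[OF w wD], simp add: adjacent_Cons_iff)+
    have c: "cancelling v ?Z b a" "cancelling v ?Z c d"
      using cancelling_antiparallel[OF _ vn(2) ad(1,2)] cancelling_parallel[OF _ vn(3) ad(3,4)]
        ds ds'
      by simp_all
    have e: "without {b, a, c, d} ?Z = D" "without {c, d} ?Z = ?Z1" "without {b, a} ?Z = ?Z2"
      unfolding parallel_word_def antiparallel_word_def by (simp_all add: simps)
    have n: "distinct [b, a, c, d]" using ds ds' by simp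
    note z = val_two_bigons[OF K' gw c n e D(2)]
    have "crossing_value u (P' @ [rgt w]) S' - crossing_value u [] (S' @ P' @ [rgt w])
      = val ?Z1 v a"
      by (rule anti[OF split(4), symmetric]) (use ds' v in auto)
    also have "val ?Z1 v a = val ?Z v a" by (rule z(3)[symmetric]) simp
    also have "\<dots> = val ?Z v w + val ?Z v c"
      by (rule val_east[OF gw z(1) _ ad(5-7)]) (use ds ds' fresh v in auto)
    also have "val ?Z v c = val ?Z2 v c" by (rule z(4)) simp
    also have "val ?Z2 v c = crossing_value u (P @ [lft w]) S"
      by (rule par[OF split(2)]) (use ds v in auto)
    finally show ?thesis using z(2)[OF wD] Dw by simp
  qed
  show "crossing_value u P (lft w # S) - crossing_value u [] (lft w # S @ P)
      = crossing_value u P' (rgt w # S') - val D u w"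
  proof -
    let ?H = "[lft d, rgt c, rgt a, lft b]" and ?X = "[rgt b, lft a, lft w]"
      and ?Y = "[rgt d, lft c, rgt w]"
    let ?Z = "?H @ substitute w ?X ?Y D"
    let ?Z1 = "antiparallel_word a b P (lft w # S)"
    let ?Z2 = "parallel_word d c P' (rgt w # S')"
    have gw: "gauss_word ?Z"
      by (rule gauss_word_substitute[OF w wD fr]) (simp add: simps, simp, blast)
    have ad: "adjacent ?Z (rgt a) (lft b)" "adjacent ?Z (rgt b) (lft a)"
        "adjacent ?Z (lft d) (rgt c)" "adjacent ?Z (rgt d) (lft c)"
        "adjacent ?Z (rgt c) (rgt a)" "adjacent ?Z (lft c) (rgt w)" "adjacent ?Z (lft a) (lft w)"
      by (rule adjacent_substitute[OF w wD], simp add: adjacent_Cons_iff)+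
    have c: "cancelling v ?Z a b" "cancelling v ?Z d c"
      using cancelling_antiparallel[OF _ vn(1) ad(1,2)] cancelling_parallel[OF _ vn(4) ad(3,4)]
        ds ds'
      by simp_all
    have e: "without {a, b, d, c} ?Z = D" "without {d, c} ?Z = ?Z1" "without {a, b} ?Z = ?Z2"
      unfolding parallel_word_def antiparallel_word_def by (simp_all add: simps)
    have n: "distinct [a, b, d, c]" using ds ds' by simp
    note z = val_two_bigons[OF K' gw c n e D(2)]
    have "crossing_value u P (lft w # S) - crossing_value u [] (lft w # S @ P) = val ?Z1 v b"
      using anti[OF split(1), of a b] ds v by simp
    also have "val ?Z1 v b = - val ?Z v a" using z(3)[of b] z(5) by simp
    also have "val ?Z v a = val ?Z v c + val ?Z v w"
      by (rule val_east[OF gw z(1) _ ad(5-7)]) (use ds ds' fresh v in auto)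
    also have "val ?Z v c = - val ?Z2 v d" using z(4)[of d] z(6) by simp
    also have "val ?Z2 v d = crossing_value u P' (rgt w # S')"
      by (rule par[OF split(3)]) (use ds' v in auto)
    finally show ?thesis using z(2)[OF wD] Dw by simp
  qed
qed

text \<open>
  \<open>F\<^sub>b(s) - F\<^sub>b(n) = \<delta>\<^sub>m\<close>, from the western and the northern relation.
\<close>

lemma crossing_value_pass_left:
  assumes w: "gauss_word (A @ lft v # B)" and K: "in_K (A @ lft v # B) u"
    and s: "A @ lft v # B = X @ rgt v # Y"
  shows "crossing_value u A (lft v # B) - crossing_value u (A @ [lft v]) B
    = crossing_value u [] (Y @ X @ [rgt v])"
proof -
  have "c - b = l" if "V = a - c" "a - l = V + b" for V a b c l :: 'a
  proof -
    have "a + - l = a + - (c - b)" using that by (simp add: algebra_simps)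
    then have "- l = - (c - b)" by (rule add_left_imp_eq)
    then show ?thesis by (simp only: neg_equal_iff_equal)
  qed
  from this[OF crossing_relations(1,2)[OF w K refl s]] show ?thesis .
qed

text \<open>
  \<open>F\<^sub>b(t) - F\<^sub>b(m) = - \<delta>\<^sub>s\<close>, from the western and the southern relation.
\<close>

lemma crossing_value_pass_right:
  assumes w: "gauss_word (A @ rgt v # B)" and K: "in_K (A @ rgt v # B) u"
    and s: "A @ rgt v # B = X @ lft v # Y"
  shows "crossing_value u A (rgt v # B) - crossing_value u (A @ [rgt v]) B
    = - crossing_value u [] (lft v # Y @ X)"
proof -
  have "t - m = - l" if "V = m - c" "c - l = t - V" for V m c t l :: 'a
  proof -
    have "c + - l = c + (t - m)" using that by (simp add: algebra_simps)
    then show ?thesis by (rule add_left_imp_eq[symmetric])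
  qed
  from this[OF crossing_relations(1,3)[OF w K s refl]] show ?thesis .
qed

end

section \<open>The parity cycle\<close>

lemma parallel_word_parts:
  assumes "gauss_word (parallel_word v w A B)"
  shows "{v, w} \<inter> fst ` set (A @ B) = {}" "without {v, w} (parallel_word v w A B) = A @ B"
    "without {v, w} A = A" "without {v, w} B = B"
proof -
  have fr: "fst t \<notin> {v, w}" if t: "t \<in> set A \<or> t \<in> set B" for t
  proof
    assume "fst t \<in> {v, w}"
    then have "t \<in> {lft v, rgt v, lft w, rgt w}"
      using gauss_word_slots[OF assms, of t] t by (cases t) (auto simp: parallel_word_def)
    then show False using assms t by (auto simp: parallel_word_def gauss_word_def)
  qed
  then show "{v, w} \<inter> fst ` set (A @ B) = {}" by auto
  show w: "without {v, w} A = A" "without {v, w} B = B"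
    using fr by (auto simp: without_def intro!: filter_True)
  show "without {v, w} (parallel_word v w A B) = A @ B"
    by (simp add: parallel_word_def without_simps(1-3) w)
qed

lemma first_kept_parallel:
  assumes g: "gauss_word (parallel_word v w A B)" and ne: "A @ B \<noteq> []"
  shows "first_kept (\<lambda>x. fst x \<notin> {v, w}) (parallel_word v w A B) (lft v) = hd (A @ B)"
    and "first_kept (\<lambda>x. fst x \<notin> {v, w}) (parallel_word v w A B) (rgt v) = hd (B @ A)"
proof -
  let ?W = "parallel_word v w A B"
  have W: "?W = [] @ lft v # rgt w # A @ rgt v # lft w # B"
    "?W = (lft v # rgt w # A) @ rgt v # lft w # B"
    by (simp_all add: parallel_word_def)
  have d: "distinct ?W" using g by (simp add: gauss_word_def)
  note parts = parallel_word_parts[OF g]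
  have "set (without {v, w} ?W) \<noteq> {}" unfolding parts(2) using ne by simp
  then have k: "\<exists>x\<in>set ?W. fst x \<notin> {v, w}" unfolding set_without by blast
  have "first_kept (\<lambda>x. fst x \<notin> {v, w}) ?W (lft v) = hd (without {v, w} ?W)"
    using first_kept_eq[OF d[unfolded W(1)] k[unfolded W(1)]] unfolding W(1)[symmetric]
    by (simp add: without_def parallel_word_def)
  then show "first_kept (\<lambda>x. fst x \<notin> {v, w}) ?W (lft v) = hd (A @ B)" unfolding parts(2) .
  have "without {v, w} (rgt v # (lft w # B) @ lft v # rgt w # A) = B @ A"
    by (simp add: without_simps(1-3) parts)
  then show "first_kept (\<lambda>x. fst x \<notin> {v, w}) ?W (rgt v) = hd (B @ A)"
    using first_kept_eq[OF d[unfolded W(2)] k[unfolded W(2)]] unfolding W(2)[symmetric]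
    by (simp add: without_def)
qed

text \<open>
  Every diagram used to define the parity cycle has a word of the expected form. The two strands
  belong to the same arc of \<open>D\<close>, so no other crossing separates them on one of the two sides.
\<close>

lemma self_r2_word:
  assumes "self_r2 D a E v"
  shows "\<exists>w q A B. r2_move E (v, North) (w, South) q D \<and> reads E (parallel_word v w A B) \<and>
    q (arc E v SW) = a \<and> q (arc E v SE) = a \<and> (A = [] \<or> B = [])"
proof -
  obtain w q where m: "r2_move E (v, North) (w, South) q D"
    and q: "q (arc E v SW) = a" "q (arc E v SE) = a"
    using assms unfolding self_r2_def by blast
  have E: "is_diagram E" and D: "is_diagram D" and vw: "v \<in> verts E" "w \<in> verts E" "v \<noteq> w"
    and e: "erase E {v, w} q D"
    and s: "arc E v NE = arc E w SE" "arc E w SW = arc E v NW"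
    using m unfolding r2_move_def by auto
  obtain W0 where W0: "reads E W0" using diagram_reads[OF E] vw(1) by blast
  have inW: "lft t \<in> set W0" "rgt t \<in> set W0" if "t \<in> verts E" for t
    using reads_set[OF W0] that not_outgoing_slots by auto
  obtain R where R: "reads E (lft v # R)" "set W0 = set (lft v # R)"
    using reads_starting_at[OF W0 inW(1)[OF vw(1)]] by metis
  let ?W = "lft v # R"
  have d: "distinct ?W" using reads_word[OF R(1)] by (simp add: gauss_word_def)
  have fol: "follows ?W x y" if "x \<in> set W0" "y \<in> set W0" "arc_from E x = arc_to E y" for x y
    using follows_iff_arcs[OF R(1), of x y] that R(2) by simp
  have "follows ?W (lft v) (rgt w)" using fol[OF inW(1)[OF vw(1)] inW(2)[OF vw(2)]] s by simp
  then have "rgt w = hd (R @ [lft v])" using follows_Cons[OF d] by blast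
  then obtain R' where R': "R = rgt w # R'" by (cases R) auto
  have "rgt v \<in> set R'" using inW(2)[OF vw(1)] R(2) R' vw(3) by auto
  then obtain A B' where AB': "R' = A @ rgt v # B'" by (meson split_list)
  have "follows ?W (rgt v) (lft w)" using fol[OF inW(2)[OF vw(1)] inW(1)[OF vw(2)]] s by simp
  then have "follows (rgt v # B' @ lft v # rgt w # A) (rgt v) (lft w)"
    using follows_rotate[of "lft v # rgt w # A" "rgt v # B'"] R' AB' by simp
  then have "lft w = hd ((B' @ lft v # rgt w # A) @ [rgt v])"
    by (subst (asm) follows_Cons) (use d R' AB' in auto)
  then obtain B where B: "B' = lft w # B" using vw(3) by (cases B') auto
  have W: "?W = parallel_word v w A B" using R' AB' B by (simp add: parallel_word_def)
  have "A = [] \<or> B = []"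
  proof (rule ccontr)
    assume "\<not> ?thesis"
    then obtain x A' y B' where xy: "A = x # A'" "B = y # B'" by (meson neq_Nil_conv)
    note wo = parallel_word_parts(2)[OF reads_word[OF R(1), unfolded W], folded W]
    have ne: "without {v, w} ?W \<noteq> []" using wo xy by simp
    note re = reads_erase[OF R(1) ne e D]
    have "A @ B \<noteq> []" using xy by simp
    note fk = first_kept_parallel[OF reads_word[OF R(1), unfolded W] this, folded W]
    have 1: "first_kept (\<lambda>t. fst t \<notin> {v, w}) ?W (lft v) = x" using fk(1) xy by simp
    have 2: "first_kept (\<lambda>t. fst t \<notin> {v, w}) ?W (rgt v) = y" using fk(2) xy by simp
    have "arc_to D x = a" using re(2)[of "lft v"] q 1 by simp
    moreover have "arc_to D y = a" using re(2)[of "rgt v"] q 2 R' AB' by simp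
    moreover have "x \<in> set (A @ B)" "y \<in> set (A @ B)" using xy by auto
    ultimately have "x = y"
      using inj_onD[OF bij_betw_imp_inj_on[OF reads_arcs[OF re(1)]], of x y] unfolding wo by simp
    then show False using d W xy by (auto simp: parallel_word_def)
  qed
  then show ?thesis using m q R(1) W by auto
qed

lemma diagram_connected:
  assumes "is_diagram D" "verts D \<noteq> {}" "a \<in> arcs D" "b \<in> arcs D"
  shows "(a, b) \<in> (steps D (verts D))\<^sup>*"
  using assms by (simp add: is_diagram_def)

lemma erase_merges:
  "erase E S q D \<Longrightarrow> a \<in> arcs E \<Longrightarrow> b \<in> arcs E \<Longrightarrow>
    (a, b) \<in> (steps E S \<union> (steps E S)\<inverse>)\<^sup>* \<Longrightarrow> q a = q b"
  by (simp add: erase_def)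

text \<open>
  With a reading \<open>A\<close> of \<open>D\<close> that begins at the end of the arc \<open>a\<close>, the word of the new diagram
  is \<open>parallel_word v w [] A\<close>. A diagram without crossings has no Gauss word and is treated
  separately, with the word of the new diagram written down directly.
\<close>

lemma self_r2_exists:
  assumes D: "is_diagram D" and a: "a \<in> arcs D"
  shows "\<exists>E v. self_r2 D a E v"
proof (cases "verts D = {}")
  case True
  let ?W = "parallel_word 0 1 [] []" and ?u = "\<lambda>t::nat. t = 0"
  let ?E = "word_diagram ?W ?u"
  have "card (arcs D) = 1" using D True unfolding is_diagram_def by simp
  then have aD: "arcs D = {a}" using a by (metis card_1_singletonE singletonD)
  have "set ?W = {0, 1} \<times> {SW, SE}" by (auto simp: parallel_word_def)
  moreover have "distinct ?W" by (simp add: parallel_word_def)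
  moreover have "?W \<noteq> []" by (simp add: parallel_word_def)
  ultimately have gw: "gauss_word ?W" unfolding gauss_word_def by blast
  have r: "reads ?E ?W" by (rule reads_word_diagram[OF gw])
  have E: "is_diagram ?E" by (rule reads_diagram[OF r])
  have V: "verts ?E = {0, 1}" by (auto simp: parallel_word_def)
  have "adjacent ?W (lft 0) (rgt 1)" "adjacent ?W (rgt 0) (lft 1)"
    unfolding parallel_word_def append.simps by (rule adjacent_here adjacent_Cons)+
  note f = this[THEN adjacent_follows, THEN reads_follows[OF r]]
  have conn: "(b, c) \<in> (steps ?E {0, 1} \<union> (steps ?E {0, 1})\<inverse>)\<^sup>*" if "b \<in> arcs ?E"
    "c \<in> arcs ?E" for b c
    using diagram_connected[OF E _ that] unfolding V
    by (rule subsetD[OF rtrancl_mono, rotated]) auto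
  have "arc_to ?E (lft 0) \<in> arcs ?E"
    by (rule bij_betw_apply[OF reads_arcs[OF r]]) (simp add: parallel_word_def)
  then have arcs_E: "(\<lambda>_. a) ` arcs ?E = arcs D" unfolding aD by blast
  have "erase ?E {0, 1} (\<lambda>_. a) D"
    unfolding erase_def arcs_E True V using conn by simp
  then have "r2_move ?E (0, North) (1, South) (\<lambda>_. a) D"
    unfolding r2_move_def using D E V f by (simp add: outgoing_def over_at_def)
  then show ?thesis unfolding self_r2_def by blast
next
  case False
  obtain W0 where W0: "reads D W0" using diagram_reads[OF D False] by blast
  have "a \<in> arc_to D ` set W0" using a reads_arcs[OF W0] by (simp add: bij_betw_def)
  then obtain x where x: "a = arc_to D x" "x \<in> set W0" by (rule imageE)
  obtain R where R: "reads D (x # R)" by (rule reads_starting_at[OF W0 x(2)])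
  let ?A = "x # R"
  obtain v w c d where vw: "distinct [v, w, c, d]" "{v, w, c, d} \<inter> fst ` set ?A = {}"
    using four_fresh[of "fst ` set ?A"] by auto
  have fr: "{v, w} \<inter> fst ` set ([] @ ?A) = {}" "v \<noteq> w" using vw by auto
  have gA: "gauss_word ([] @ ?A)" using reads_word[OF R] by simp
  note g = gauss_word_parallel[OF gA fr]
  let ?W = "parallel_word v w [] ?A" and ?u = "(up_right_over D)(v := True, w := False)"
  let ?E = "word_diagram ?W ?u"
  have r: "reads ?E ?W" by (rule reads_word_diagram[OF g(1)])
  have rD: "reads D (without {v, w} ?W)" unfolding g(3) using R by simp
  have "adjacent ?W (lft v) (rgt w)" "adjacent ?W (rgt v) (lft w)"
    unfolding parallel_word_def append.simps by (rule adjacent_here adjacent_Cons)+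
  note f = this[THEN adjacent_follows]
  have "\<exists>q. r2_move ?E (v, North) (w, South) q D \<and>
           (\<forall>x\<in>set ?W. q (arc_to ?E x) = arc_to D (first_kept (\<lambda>x. fst x \<notin> {v, w}) ?W x))"
  proof (rule r2_north_south[OF r rD f fr(2)])
    show "up_right_over ?E v \<noteq> up_right_over ?E w" using fr(2) by simp
    fix t assume "t \<in> verts D"
    then have "t \<noteq> v" "t \<noteq> w" using reads_verts[OF R] fr(1) by auto
    then show "up_right_over D t = up_right_over ?E t" by simp
  qed
  then obtain q where q: "r2_move ?E (v, North) (w, South) q D"
    "\<forall>x\<in>set ?W. q (arc_to ?E x) = arc_to D (first_kept (\<lambda>x. fst x \<notin> {v, w}) ?W x)"
    by blast
  have "[] @ ?A \<noteq> []" by simp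
  note fk = first_kept_parallel[OF g(1) this]
  have "q (arc ?E v SW) = a" using q(2)[rule_format, of "lft v"] fk(1) x(1)
    by (simp add: parallel_word_def)
  moreover have "q (arc ?E v SE) = a" using q(2)[rule_format, of "rgt v"] fk(2) x(1)
    by (simp add: parallel_word_def)
  ultimately show ?thesis unfolding self_r2_def using q(1) by blast
qed

text \<open>
  By existence, the description defining the parity cycle denotes any value that all choices
  share.
\<close>

lemma parity_cycle_eqI:
  assumes "is_diagram D" "a \<in> arcs D" "\<And>E v. self_r2 D a E v \<Longrightarrow> p E v = t"
  shows "parity_cycle p D a = t"
  unfolding parity_cycle_def
proof (rule the_equality)
  obtain E v where "self_r2 D a E v" using self_r2_exists[OF assms(1,2)] by blast
  then show "\<exists>E v. self_r2 D a E v \<and> t = p E v" using assms(3) by blast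
qed (use assms(3) in blast)

context parity_on begin

text \<open>
  The coefficients of the parity cycle are the values \<open>\<delta>\<^sub>e = F\<^sub>e(e)\<close>; both cases of
  \<open>self_r2_word\<close> give the same value by \<open>crossing_value_loop\<close>.
\<close>

lemma parity_cycle_loop:
  assumes DK: "D \<in> K" and r: "reads D W"
  shows "parity_cycle p D (arc_to D (hd W)) = crossing_value (up_right_over D) [] W"
proof (rule parity_cycle_eqI)
  have ne: "W \<noteq> []" using reads_word[OF r] by (simp add: gauss_word_def)
  show "is_diagram D" by (rule reads_diagram[OF r])
  show "arc_to D (hd W) \<in> arcs D" using bij_betw_apply[OF reads_arcs[OF r]] ne by simp
  fix E v assume "self_r2 D (arc_to D (hd W)) E v"
  then obtain w q A B where m: "r2_move E (v, North) (w, South) q D"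
    and E: "reads E (parallel_word v w A B)" and q: "q (arc E v SW) = arc_to D (hd W)"
      and AB: "A = [] \<or> B = []"
    using self_r2_word by blast
  let ?Z = "parallel_word v w A B"
  have EK: "E \<in> K" by (rule p_r2(1)[OF m disjI2[OF DK]])
  have e: "erase E {v, w} q D" and vw: "v \<noteq> w" "up_right_over E v \<noteq> up_right_over E w"
    using m by (auto simp: r2_move_def over_at_def)
  have sets: "verts D = verts E - {v, w}" using e by (simp add: erase_def)
  note parts = parallel_word_parts[OF reads_word[OF E]]
  note wZ = parts(2)
  have vZ: "fst ` set (A @ B) = verts D"
    using arg_cong[OF wZ, of set] reads_verts[OF E] unfolding sets set_without by auto
  have "verts D \<noteq> {}" using reads_verts[OF r] ne by simp
  then have neAB: "without {v, w} ?Z \<noteq> []" using vZ unfolding wZ by (cases "A @ B") auto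
  note re = reads_erase[OF E neAB e reads_diagram[OF r]]
  have rAB: "reads D (A @ B)" using re(1) unfolding wZ .
  have "first_kept (\<lambda>t. fst t \<notin> {v, w}) ?Z (lft v) = hd (A @ B)"
    by (rule first_kept_parallel(1)[OF reads_word[OF E]]) (use neAB wZ in simp)
  then have "arc_to D (hd W) = arc_to D (hd (A @ B))"
    using re(2)[of "lft v"] q by (simp add: parallel_word_def)
  moreover have "hd W \<in> set W" using ne by simp
  moreover have "hd (A @ B) \<in> set (A @ B)" using neAB unfolding wZ by (rule hd_in_set)
  then have "hd (A @ B) \<in> set W" unfolding reads_set[OF r] reads_set[OF rAB] .
  ultimately have "hd W = hd (A @ B)"
    using inj_onD[OF bij_betw_imp_inj_on[OF reads_arcs[OF r]]] by blast
  then have W: "W = A @ B" by (rule reads_unique[OF r rAB])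
  have "p E v = val ?Z (up_right_over E) v"
    by (rule val_reads(2)[OF EK E]) (use reads_verts[OF E] in \<open>auto simp: parallel_word_def\<close>)
  also have "\<dots> = crossing_value (up_right_over D) A B"
  proof (rule val_parallel_word)
    show "gauss_word (A @ B)" by (rule reads_word[OF rAB])
    show "in_K (A @ B) (up_right_over D)" by (rule in_K_reads[OF DK rAB])
    show "{v, w} \<inter> fst ` set (A @ B) = {}" by (rule parts(1))
    show "up_right_over E t = up_right_over D t" if "t \<in> fst ` set (A @ B)" for t
      using that e unfolding vZ by (simp add: erase_def)
  qed (rule vw)+
  also have "\<dots> = crossing_value (up_right_over D) [] W"
    using AB crossing_value_loop[OF reads_word[OF rAB] in_K_reads[OF DK rAB]] W by auto
  finally show "p E v = crossing_value (up_right_over D) [] W" .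
qed

end

section \<open>Intersection numbers\<close>

text \<open>
  The contributions to the intersection number of \<open>x\<close> and \<open>y\<close>, grouped by the passages of \<open>x\<close>: a
  passage from SW uses the arc NE and meets \<open>y\<close> on the arc NW, a passage from SE uses the arc SE
  and meets \<open>y\<close> on the arc SW.
\<close>

definition passage_term :: "diagram \<Rightarrow> (nat \<Rightarrow> 'a::ab_group_add) \<Rightarrow> nat \<times> slot \<Rightarrow> 'a" where
  "passage_term D y x = (if snd x = SW then y (arc D (fst x) NW) else - y (arc D (fst x) SW))"

lemma int_scale_01: "int_scale (if b then 1 else 0) y = (if b then y else 0)"
  by (simp add: int_scale_def)

lemma intersection_passages:
  assumes r: "reads D W" and S: "S \<subseteq> set W"
    and x1: "\<And>v. v \<in> verts D \<Longrightarrow> x (arc D v NE) = (if lft v \<in> S then 1 else 0)"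
    and x2: "\<And>v. v \<in> verts D \<Longrightarrow> x (arc D v SE) = (if rgt v \<in> S then 1 else 0)"
  shows "intersection D x y = sum (passage_term D y) S"
proof -
  let ?V = "verts D"
  have fin: "finite ?V" using reads_verts[OF r] by simp
  let ?L = "{v \<in> ?V. lft v \<in> S}" and ?R = "{v \<in> ?V. rgt v \<in> S}"
  have S_eq: "S = lft ` ?L \<union> rgt ` ?R"
  proof
    show "S \<subseteq> lft ` ?L \<union> rgt ` ?R"
    proof
      fix t assume t: "t \<in> S"
      then have "t \<in> set W" using S by blast
      then have "fst t \<in> ?V" "snd t = SW \<or> snd t = SE"
        using reads_verts[OF r] gauss_word_slots[OF reads_word[OF r]] by auto
      then show "t \<in> lft ` ?L \<union> rgt ` ?R" using t by (cases t) auto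
    qed
  qed auto
  have "sum (passage_term D y) S = sum (passage_term D y) (lft ` ?L \<union> rgt ` ?R)"
    by (rule arg_cong[OF S_eq])
  also have "\<dots> = sum (passage_term D y) (lft ` ?L) + sum (passage_term D y) (rgt ` ?R)"
    by (rule sum.union_disjoint) (use fin in auto)
  also have "sum (passage_term D y) (lft ` ?L) = (\<Sum>v\<in>?L. y (arc D v NW))"
    by (subst sum.reindex) (auto simp: inj_on_def passage_term_def)
  also have "sum (passage_term D y) (rgt ` ?R) = (\<Sum>v\<in>?R. - y (arc D v SW))"
    by (subst sum.reindex) (auto simp: inj_on_def passage_term_def)
  also have "(\<Sum>v\<in>?L. y (arc D v NW)) = (\<Sum>v\<in>?V. if lft v \<in> S then y (arc D v NW) else 0)"
    by (rule sum.inter_filter[OF fin])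
  also have "(\<Sum>v\<in>?R. - y (arc D v SW)) = (\<Sum>v\<in>?V. if rgt v \<in> S then - y (arc D v SW) else 0)"
    by (rule sum.inter_filter[OF fin])
  also have "(\<Sum>v\<in>?V. if lft v \<in> S then y (arc D v NW) else 0) + (\<Sum>v\<in>?V. if rgt v \<in> S then - y
    (arc D v SW) else 0)
    = intersection D x y"
    unfolding intersection_def sum.distrib[symmetric]
    by (rule sum.cong) (simp_all add: x1 x2 int_scale_01)
  finally show ?thesis ..
qed

lemma intersection_whole:
  assumes r: "reads D W" shows "intersection D (whole D) y = sum (passage_term D y) (set W)"
proof (rule intersection_passages[OF r subset_refl])
  fix v assume v: "v \<in> verts D"
  then have in_W: "lft v \<in> set W" "rgt v \<in> set W" using reads_set[OF r] not_outgoing_slots by auto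
  obtain z where z: "z \<in> set W" "follows W (lft v) z" using follows_ex[OF in_W(1)] by blast
  have "arc D v NE \<in> arcs D" using reads_follows[OF r z(2)] bij_betw_apply[OF reads_arcs[OF r]
    z(1)] by simp
  then show "whole D (arc D v NE) = (if lft v \<in> set W then 1 else 0)" using in_W
    by (simp add: whole_def)
  have "arc D v SE \<in> arcs D" using bij_betw_apply[OF reads_arcs[OF r] in_W(2)] by simp
  then show "whole D (arc D v SE) = (if rgt v \<in> set W then 1 else 0)" using in_W
    by (simp add: whole_def)
qed

text \<open>
  The left half leaves \<open>w\<close> after its passage from SE and returns to \<open>w\<close> from SW, so it makes the
  passages in \<open>L\<close>. The two passages of \<open>w\<close> do not count, since neither the arc NE nor the arc SE
  of \<open>w\<close> belongs to the left half.
\<close>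

lemma intersection_left_half:
  assumes r: "reads D (lft w # R @ rgt w # L)"
  shows "intersection D (left_half D w) y = sum (passage_term D y) (set L)"
proof -
  have r': "reads D (rgt w # L @ lft w # R)"
    using reads_rotate[of D "lft w # R" "rgt w # L"] r by simp
  let ?W = "rgt w # L @ lft w # R"
  have d: "distinct ?W" using reads_word[OF r'] by (simp add: gauss_word_def)
  have V: "verts D = fst ` set ?W" by (rule reads_verts[OF r'])
  have Lw: "fst t \<noteq> w" if "t \<in> set L" for t
  proof
    assume "fst t = w"
    then have "t = lft w \<or> t = rgt w" using gauss_word_slots[OF reads_word[OF r'], of t] that
      by (cases t) auto
    then show False using d that by auto
  qed
  have inj: "s = t" if "arc_to D s = arc_to D t" "s \<in> set ?W" "t \<in> set ?W" for s t
    using inj_onD[OF bij_betw_imp_inj_on[OF reads_arcs[OF r']] that] .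
  have next_in: "t \<in> set (L @ [lft w]) \<longleftrightarrow> s \<in> set (rgt w # L)" if f: "follows ?W s t" for s t
  proof
    assume "s \<in> set (rgt w # L)"
    then obtain P Q where PQ: "rgt w # L = P @ s # Q" by (meson split_list)
    then have "?W = P @ s # hd (Q @ [lft w]) # tl (Q @ [lft w]) @ R"
      by (cases Q) (auto simp flip: append_Cons)
    then have "follows ?W s (hd (Q @ [lft w]))" using follows_append by metis
    then have "t = hd (Q @ [lft w])" using follows_unique[OF d f] by blast
    then show "t \<in> set (L @ [lft w])" using PQ by (cases Q; cases P) auto
  next
    assume "t \<in> set (L @ [lft w])"
    then obtain P Q where PQ: "L @ [lft w] = P @ t # Q" by (meson split_list)
    then have W': "?W = butlast (rgt w # P) @ last (rgt w # P) # t # Q @ R"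
      by (metis append.assoc append_Cons append_Nil append_butlast_last_id list.distinct(1))
    then have "follows ?W (last (rgt w # P)) t" using follows_append by metis
    then have "s = last (rgt w # P)" using follows_inj[OF d f] by blast
    moreover have "set P \<subseteq> set L" using PQ by (cases Q rule: rev_cases) auto
    ultimately show "s \<in> set (rgt w # L)" by (cases P rule: rev_cases) auto
  qed
  have NW: "arc D w NW = arc_to D (hd (L @ [lft w]))"
  proof -
    have "follows ?W (rgt w) (hd (L @ [lft w]))" unfolding follows_Cons[OF d] by (cases L) auto
    from reads_follows[OF r' this] show ?thesis by simp
  qed
  have reach: "(arc D w NW, a) \<in> (steps D (verts D - {w}))\<^sup>* \<longleftrightarrow> a \<in> arc_to D ` set (L @ [lft w])"
    for a
  proof
    assume "(arc D w NW, a) \<in> (steps D (verts D - {w}))\<^sup>*"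
    then show "a \<in> arc_to D ` set (L @ [lft w])"
    proof (induction rule: rtrancl_induct)
      case base
      show ?case unfolding NW by (rule imageI[OF hd_in_set]) simp
    next
      case (step b c)
      obtain s t where st: "follows ?W s t" "fst s \<in> verts D - {w}" "b = arc_to D s"
        "c = arc_to D t"
        using step(2) reads_steps_iff[OF r', of "verts D - {w}"] by blast
      obtain z where z: "z \<in> set (L @ [lft w])" "b = arc_to D z" using step(3) by blast
      have "s = z" by (rule inj) (use z st follows_in[OF st(1)] in auto)
      then have "s \<in> set L" using z(1) st(2) by auto
      then have "t \<in> set (L @ [lft w])" using next_in[OF st(1)] by simp
      then show ?case using st(4) by blast
    qed
  next
    assume "a \<in> arc_to D ` set (L @ [lft w])"
    then obtain z where z: "z \<in> set (L @ [lft w])" "a = arc_to D z" by blast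
    then obtain P Q where PQ: "L @ [lft w] = P @ z # Q" by (meson split_list)
    have W': "?W = [rgt w] @ P @ z # (Q @ R)" using PQ
      by (metis append.assoc append_Cons append_Nil)
    have PL: "set P \<subseteq> set L" using PQ by (cases Q rule: rev_cases) auto
    then have sub: "fst ` set P \<subseteq> verts D - {w}" using Lw unfolding V by auto
    have "hd (P @ [z]) = hd (L @ [lft w])" using PQ by (cases P) auto
    then show "(arc D w NW, a) \<in> (steps D (verts D - {w}))\<^sup>*"
      using reads_chain[of D "[rgt w]" P z "Q @ R", OF r'[unfolded W'] sub] NW z(2) by simp
  qed
  have lh: "left_half D w a = (if a \<in> arc_to D ` set (L @ [lft w]) then 1 else 0)" for a
    unfolding left_half_def using reach by simp
  have im: "arc_to D t \<in> arc_to D ` set (L @ [lft w]) \<longleftrightarrow> t \<in> set (L @ [lft w])" if "t \<in> set ?W" for t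
  proof
    assume "arc_to D t \<in> arc_to D ` set (L @ [lft w])"
    then obtain z where "z \<in> set (L @ [lft w])" "arc_to D t = arc_to D z" by blast
    then show "t \<in> set (L @ [lft w])" using inj[OF _ that, of z] by auto
  qed (rule imageI)
  show ?thesis
  proof (rule intersection_passages[OF r'])
    show "set L \<subseteq> set ?W" by auto
    fix v assume v: "v \<in> verts D"
    then have in_W: "lft v \<in> set ?W" "rgt v \<in> set ?W"
      using reads_set[OF r'] not_outgoing_slots by auto
    obtain z where z: "z \<in> set ?W" "follows ?W (lft v) z" using follows_ex[OF in_W(1)] by blast
    have "arc D v NE = arc_to D z" using reads_follows[OF r' z(2)] by simp
    moreover have "z \<in> set (L @ [lft w]) \<longleftrightarrow> lft v \<in> set L" using next_in[OF z(2)] by simp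
    ultimately show "left_half D w (arc D v NE) = (if lft v \<in> set L then 1 else 0)"
      unfolding lh using im[OF z(1)] by simp
    have "rgt v \<in> set (L @ [lft w]) \<longleftrightarrow> rgt v \<in> set L" by auto
    then show "left_half D w (arc D v SE) = (if rgt v \<in> set L then 1 else 0)"
      unfolding lh using im[OF in_W(2)] by simp
  qed
qed

section \<open>The two constructions are inverse to each other\<close>

context parity_on begin

text \<open>
  Every passage contributes the difference of the crossing values before and behind it, by
  \<open>crossing_value_pass_left\<close> and \<open>crossing_value_pass_right\<close>.
\<close>

lemma telescope:
  assumes DK: "D \<in> K" and r: "reads D (A @ L)"
  shows "sum (passage_term D (parity_cycle p D)) (set L)
    = crossing_value (up_right_over D) A L - crossing_value (up_right_over D) (A @ L) []"
  using r
proof (induction L arbitrary: A)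
  case Nil then show ?case by simp
next
  case (Cons x L)
  let ?u = "up_right_over D" and ?W = "A @ x # L"
  have w: "gauss_word ?W" by (rule reads_word[OF Cons.prems])
  have K: "in_K ?W ?u" by (rule in_K_reads[OF DK Cons.prems])
  have d: "distinct ?W" using w by (simp add: gauss_word_def)
  have IH: "sum (passage_term D (parity_cycle p D)) (set L)
      = crossing_value ?u (A @ [x]) L - crossing_value ?u ?W []"
    using Cons.IH[of "A @ [x]"] Cons.prems by simp
  have x: "passage_term D (parity_cycle p D) x
    = crossing_value ?u A (x # L) - crossing_value ?u (A @ [x]) L"
  proof -
    obtain v where v: "x = lft v \<or> x = rgt v" using gauss_word_slots[OF w, of x] by (cases x) auto
    have "fst x \<in> verts D" using reads_verts[OF Cons.prems] by simp
    then have in_W: "lft v \<in> set ?W" "rgt v \<in> set ?W"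
      using v reads_set[OF Cons.prems] not_outgoing_slots by auto
    from v show ?thesis
    proof
      assume x: "x = lft v"
      obtain X Y where XY: "?W = X @ rgt v # Y" using in_W(2) by (meson split_list)
      have r': "reads D (Y @ X @ [rgt v])"
        using reads_rotate[of D "X @ [rgt v]" Y] Cons.prems XY by simp
      have "follows ?W (rgt v) (hd (Y @ X @ [rgt v]))" unfolding follows_def using XY by blast
      from reads_follows[OF Cons.prems this] have "arc D v NW
        = arc_to D (hd (Y @ X @ [rgt v]))" by simp
      then show ?thesis
        using parity_cycle_loop[OF DK r'] crossing_value_pass_left[of A v L ?u X Y] w K XY x
        by (simp add: passage_term_def)
    next
      assume x: "x = rgt v"
      obtain X Y where XY: "?W = X @ lft v # Y" using in_W(1) by (meson split_list)
      have r': "reads D (lft v # Y @ X)"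
        using reads_rotate[of D X "lft v # Y"] Cons.prems XY by simp
      show ?thesis
        using parity_cycle_loop[OF DK r'] crossing_value_pass_right[of A v L ?u X Y] w K XY x
        by (simp add: passage_term_def)
    qed
  qed
  have "x \<notin> set L" using d by simp
  then show ?case using IH x by simp
qed

text \<open>
  The word is read so that it begins with the passage of \<open>v\<close> from SW. The auxiliary strand \<open>b\<close>
  is then a piece of the arc \<open>s\<close> itself, and \<open>F\<^sub>b(s)\<close> is the crossing value both at the
  beginning and at the end of the word.
\<close>

lemma cycle_parity_parity_cycle:
  assumes DK: "D \<in> K" and D: "is_diagram D" and v: "v \<in> verts D"
  shows "cycle_parity (parity_cycle p) D v = p D v"
proof -
  obtain W0 where W0: "reads D W0" using diagram_reads[OF D] v by blast
  have in_W: "lft v \<in> set W0" "rgt v \<in> set W0" using reads_set[OF W0] v not_outgoing_slots by auto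
  obtain R0 where R0: "reads D (lft v # R0)" "set W0 = set (lft v # R0)"
    using reads_starting_at[OF W0 in_W(1)] by metis
  have "rgt v \<in> set R0" using in_W(2) R0(2) by auto
  then obtain R L where RL: "R0 = R @ rgt v # L" by (meson split_list)
  let ?W = "lft v # R @ rgt v # L" and ?u = "up_right_over D"
  have r: "reads D ?W" using R0(1) RL by simp
  have w: "gauss_word ?W" by (rule reads_word[OF r])
  have K: "in_K ?W ?u" by (rule in_K_reads[OF DK r])
  have "cycle_parity (parity_cycle p) D v = sum (passage_term D (parity_cycle p D)) (set L)"
    unfolding cycle_parity_def by (rule intersection_left_half[OF r])
  also have "\<dots> = crossing_value ?u (lft v # R @ [rgt v]) L - crossing_value ?u ?W []"
    using telescope[OF DK, of "lft v # R @ [rgt v]" L] r by simp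
  also have "crossing_value ?u ?W [] = crossing_value ?u [] ?W"
    by (rule crossing_value_loop[OF w K, symmetric])
  also have "crossing_value ?u (lft v # R @ [rgt v]) L - crossing_value ?u [] ?W
      = crossing_value ?u ((lft v # R) @ [rgt v]) L - crossing_value ?u [] (lft v # R @ rgt v # L)"
    by simp
  also have "\<dots> = val ?W ?u v"
    by (rule crossing_relations(1)[OF w K, symmetric]) simp_all
  also have "\<dots> = p D v" by (rule val_reads(2)[OF DK r _ v, symmetric]) simp
  finally show ?thesis .
qed

end

context move_closed begin

text \<open>
  The left half makes the passage of \<open>w\<close> from SW and those in \<open>B\<close>. The first one contributes the
  coefficient of the arc NW of \<open>w\<close>, which lies on the old arc \<open>a\<close>. The others cancel because the
  sum over all passages is zero and the four passages of the bigon contribute zero together.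
\<close>

lemma parity_cycle_cycle_parity:
  assumes inv: "invariant_normalized_cycle K \<delta>" and DK: "D \<in> K" and D: "is_diagram D"
    and a: "a \<in> arcs D"
  shows "parity_cycle (cycle_parity \<delta>) D a = \<delta> D a"
proof (rule parity_cycle_eqI[OF D a])
  fix E v assume "self_r2 D a E v"
  then obtain w q A B where m: "r2_move E (v, North) (w, South) q D"
    and E: "reads E (parallel_word v w A B)" and q: "q (arc E v SW) = a" and AB: "A = [] \<or> B = []"
    using self_r2_word by blast
  let ?Z = "parallel_word v w A B"
  note mv = move.r2[OF m]
  have EK: "E \<in> K" using move_in_iff[OF mv] DK by blast
  have e: "erase E {v, w} q D" and vw: "v \<noteq> w" using m by (auto simp: r2_move_def)
  have d: "distinct ?Z" using reads_word[OF E] by (simp add: gauss_word_def)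
  have "adjacent ?Z (lft v) (rgt w)" "adjacent ?Z (rgt v) (lft w)"
    unfolding parallel_word_def by (rule adjacent_rules)+
  note f = this[THEN adjacent_follows, THEN reads_follows[OF E]]
  have side: "departing_arc E (v, North) = arc E w SE" "departing_arc E (w, South) = arc E w SW"
    using f by (simp_all add: departing_arc_def)
  have inv_move: "\<delta> D1 b = \<delta> D2 c" if "D1 \<in> K" "move D1 D2 F C" "(b, c) \<in> C" for D1 D2 F C b c
    using inv that unfolding invariant_normalized_cycle_def by blast
  have inj: "s = t" if "arc_to E s = arc_to E t" "s \<in> set ?Z" "t \<in> set ?Z" for s t
    using inj_onD[OF bij_betw_imp_inj_on[OF reads_arcs[OF E]] that] .
  have in_Z: "lft v \<in> set ?Z" "rgt v \<in> set ?Z" "lft w \<in> set ?Z" "rgt w \<in> set ?Z"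
    by (auto simp: parallel_word_def)
  have \<delta>: "\<delta> E (arc_to E t) = \<delta> D (q (arc_to E t))" if t: "t \<in> set ?Z" "t \<noteq> rgt w" "t \<noteq> lft w" for t
  proof -
    have "arc_to E t \<noteq> arc E w SE" using inj[of t "rgt w"] t in_Z by auto
    moreover have "arc_to E t \<noteq> arc E w SW" using inj[of t "lft w"] t in_Z by auto
    moreover have "arc_to E t \<in> arcs E" by (rule bij_betw_apply[OF reads_arcs[OF E] t(1)])
    ultimately have "(arc_to E t, q (arc_to E t)) \<in>
        {(b, q b) | b. b \<in> arcs E - {departing_arc E (v, North), departing_arc E (w, South)}}"
      unfolding side by blast
    then show ?thesis by (rule inv_move[OF EK mv])
  qed
  have first: "\<delta> E (arc E v SW) = \<delta> D a" using \<delta>[of "lft v"] in_Z q vw by simp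
  have last: "\<delta> E (arc E w NW) = \<delta> D a"
  proof -
    let ?t = "hd (A @ [rgt v])"
    have t: "?t \<in> set (A @ [rgt v])" by (rule hd_in_set) simp
    have "?Z = [lft v] @ rgt w # ?t # tl (A @ [rgt v]) @ lft w # B"
      by (cases A) (simp_all add: parallel_word_def)
    then have "follows ?Z (rgt w) ?t" using follows_append by metis
    then have NW: "arc E w NW = arc_to E ?t" using reads_follows[OF E] by fastforce
    have "(arc E v SW, arc E w SE) \<in> steps E {v, w}" "(arc E w SE, arc E w NW) \<in> steps E {v, w}"
      unfolding steps_def using f(1)
      by (force simp: outgoing_def)+
    then have conn: "(arc E v SW, arc E w NW) \<in> (steps E {v, w} \<union> (steps E {v, w})\<inverse>)\<^sup>*"
      by (meson UnI1 converse_rtrancl_into_rtrancl r_into_rtrancl)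
    have in_arcs: "arc E v SW \<in> arcs E" "arc E w NW \<in> arcs E"
      using bij_betw_apply[OF reads_arcs[OF E] in_Z(1)] bij_betw_apply[OF reads_arcs[OF E], of
        ?t] t NW
      by (auto simp: parallel_word_def)
    have "q (arc E w NW) = a" using erase_merges[OF e in_arcs conn] q by simp
    moreover have "?t \<in> set ?Z" "?t \<noteq> rgt w" "?t \<noteq> lft w" using t d
      by (auto simp: parallel_word_def)
    ultimately show ?thesis using \<delta>[of ?t] NW by simp
  qed
  have LH: "cycle_parity \<delta> E v = sum (passage_term E (\<delta> E)) (set (lft w # B))"
    unfolding cycle_parity_def
    by (rule intersection_left_half[of E v "rgt w # A"]) (use E in \<open>simp add: parallel_word_def\<close>)
  also have "\<dots> = \<delta> D a + sum (passage_term E (\<delta> E)) (set B)"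
    using d last by (simp add: parallel_word_def passage_term_def)
  also have "sum (passage_term E (\<delta> E)) (set B) = 0"
  proof (cases "B = []")
    case False
    then have "A = []" using AB by blast
    have "sum (passage_term E (\<delta> E)) (set ?Z) = 0"
      using inv EK intersection_whole[OF E, of "\<delta> E"]
        unfolding invariant_normalized_cycle_def by simp
    then have "\<delta> E (arc E v NW) - \<delta> E (arc E w SW) - \<delta> E (arc E v SW) + \<delta> E (arc E w NW)
        + sum (passage_term E (\<delta> E)) (set B) = 0"
      using d \<open>A = []\<close> by (simp add: parallel_word_def passage_term_def algebra_simps)
    then show ?thesis using f(2) first last by simp
  qed simp
  finally show "cycle_parity \<delta> E v = \<delta> D a" by simp
qed

end

lemma move_diagrams: "move D D' F C \<Longrightarrow> is_diagram D \<and> is_diagram D'"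
  by (induction rule: move.induct) (auto simp: iso_move_def r1_move_def r2_move_def r3_move_def)

theorem proposition4:
  fixes K :: "diagram set"
  assumes "virtual_knot K"
  shows "(\<forall>p :: diagram \<Rightarrow> nat \<Rightarrow> 'a::ab_group_add.
            oriented_parity K p \<longrightarrow>
            (\<forall>D\<in>K. \<forall>v\<in>verts D. cycle_parity (parity_cycle p) D v = p D v)) \<and>
         (\<forall>\<delta> :: diagram \<Rightarrow> nat \<Rightarrow> 'a.
            invariant_normalized_cycle K \<delta> \<longrightarrow>
            (\<forall>D\<in>K. \<forall>a\<in>arcs D. parity_cycle (cycle_parity \<delta>) D a = \<delta> D a))"
proof -
  let ?M = "{(E, E'). \<exists>F C. move E E' F C}"
  obtain D0 where D0: "is_diagram D0" "K = {D'. (D0, D') \<in> ?M\<^sup>*}"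
    using assms unfolding virtual_knot_def by blast
  interpret move_closed K
  proof
    fix D D' F C assume "D \<in> K" "move D D' F C"
    then show "D' \<in> K" unfolding D0(2) by (auto intro: rtrancl_into_rtrancl)
  qed
  have di: "is_diagram D" if "D \<in> K" for D
  proof -
    have "(D0, D) \<in> ?M\<^sup>*" using that D0(2) by blast
    then show ?thesis by (induction rule: rtrancl_induct) (use D0(1) move_diagrams in auto)
  qed
  show ?thesis
  proof (intro conjI allI impI ballI)
    fix p :: "diagram \<Rightarrow> nat \<Rightarrow> 'a" and D v
    assume p: "oriented_parity K p" and D: "D \<in> K" "v \<in> verts D"
    interpret parity_on K p by unfold_locales (rule p)
    show "cycle_parity (parity_cycle p) D v = p D v"
      by (rule cycle_parity_parity_cycle[OF D(1) di[OF D(1)] D(2)])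
  next
    fix \<delta> :: "diagram \<Rightarrow> nat \<Rightarrow> 'a" and D a
    assume "invariant_normalized_cycle K \<delta>" "D \<in> K" "a \<in> arcs D"
    then show "parity_cycle (cycle_parity \<delta>) D a = \<delta> D a"
      by (intro parity_cycle_cycle_parity di)
  qed
qed

end
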